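(* Let $\Omega\subset\mathbb{R}^2$ be an open, bounded, simply connected domain with Lipschitz boundary, let $\nu>0$, $\alpha>0$, $\beta>0$, $\delta\ge1$, $\gamma\in(0,1)$, and $f\in L^2(\Omega)$. Let $V_h^{DG}$, $A_{DG}$ and the constant $C_\Omega^{DG}>0$ be as in the context. Suppose $$\nu+\beta\gamma C_\Omega^{DG}>\beta(1+\gamma)^2C_\Omega^{DG}+\frac{2\alpha^2}{\beta},$$ and let $k_{DG}$ (the radius of the sphere $\{v\in V_h^{DG}:\|v\|_{L^2(\Omega)}=k_{DG}\}$) satisfy $$k_{DG}>\frac{C_\Omega^{DG}}{\nu\sqrt{\nu+\beta\gamma C_\Omega^{DG}-\beta(1+\gamma)^2C_\Omega^{DG}-\frac{2\alpha^2}{\beta}}}\,\|f\|_{L^2(\Omega)} .$$ Then the problem of finding $u_h^{DG}\in V_h^{DG}$ with $A_{DG}(u_h^{DG},\chi)=(f,\chi)$ for all $\chi\in V_h^{DG}$ admits at least one solution.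
   Context: $\mathcal T_h$ is a partition of $\Omega$ into shape-regular triangular or rectangular cells $K$, with interior edges $\mathcal E_h^i$, boundary edges $\mathcal E_h^\partial$ and all edges $\mathcal E_h$; $h_E$ is the length of $E$. For an interior edge $E=K_+\cap K_-$, $w_\pm$ are the traces from $K_\pm$ and $\boldsymbol n_\pm$ the unit outward normals to $K_\pm$; the jump is $[\![w]\!]=w_+-w_-$ on interior edges and $[\![w]\!]=w_+$ on boundary edges. On $\partial K$, $u^e$ is the trace of $u$ from outside $K$, with $u^e=0$ on $\partial\Omega$; $\boldsymbol n_K$ is the unit outward normal to $K$ and all other traces are taken from inside $K$. $\nabla_h$ is the piecewise gradient. $$V_h^{DG}=\{v\in L^2(\Omega): v|_K\in\mathcal P_1(K)\ \text{for all }K\in\mathcal T_h\},$$ where $\mathcal P_1(K)$ is the space of polynomials on $K$ of partial degree (at most) 1. The form $A_{DG}$ is $$A_{DG}(v,\chi)=\nu\,a_{DG}(v,\chi)+\alpha\,b_{DG}\big((v^\delta,v^\delta)^T;v,\chi\big)-\beta\big(v(1-v^\delta)(v^\delta-\gamma),\chi\big),$$ where $(\cdot,\cdot)$ is the $L^2(\Omega)$ inner product, $$\begin{aligned}a_{DG}(u,v)={}&(\nabla_hu,\nabla_hv)+\sum_{E\in\mathcal E_h^i}\int_E\Big(\tfrac{\sigma}{h_E}[\![u]\!][\![v]\!]-\tfrac12(\nabla u_++\nabla u_-)\cdot\boldsymbol n_+[\![v]\!]-\tfrac12(\nabla v_++\nabla v_-)\cdot\boldsymbol n_+[\![u]\!]\Big)ds\\&+\sum_{E\in\mathcal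 E_h^\partial}\int_E\Big(\tfrac{2\sigma}{h_E}uv-(\nabla u\cdot\boldsymbol n)v-(\nabla v\cdot\boldsymbol n)u\Big)ds,\end{aligned}$$ $$b_{DG}(\boldsymbol w;u,v)=\sum_{K\in\mathcal T_h}\int_K(\boldsymbol w\cdot\nabla u)\,v\,dx+\sum_{K\in\mathcal T_h}\frac12\int_{\partial K}\big[\boldsymbol w\cdot\boldsymbol n_K(u^e-u)-|\boldsymbol w\cdot\boldsymbol n_K|(u^e-u)\big]v\,ds .$$ The penalty parameter $\sigma>0$ is chosen sufficiently large to guarantee stability, i.e. so that $a_{DG}(v,v)\ge\alpha_a|||v|||^2$ for all $v\in V_h^{DG}$ with some $\alpha_a>0$, where $$|||v|||^2=\sum_{K\in\mathcal T_h}\|\nabla v\|_{L^2(K)}^2+\sum_{E\in\mathcal E_h}\|[\![v]\!]\|_{L^2(E)}^2 .$$ $C_\Omega^{DG}$ is the discrete Poincaré–Friedrichs constant: $\|v\|_{L^2(\Omega)}^2\le C_\Omega^{DG}|||v|||^2$ for all $v\in V_h^{DG}$. Power convention: if $\delta$ is an integer, $s^\delta$ is the usual power; if $\delta$ is not an integer, $s^{\delta}$ means $|s|^{\delta}$ for $s\in\mathbb{R}$. *)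

theory Defs
  imports "HOL-Analysis.Analysis"
begin

section \<open>The domain\<close>

text \<open>Near every boundary point \<open>p\<close>, in orthonormal coordinates \<open>(s, t)\<close> centred at \<open>p\<close>,
  \<open>\<Omega>\<close> is the region strictly above the graph of a Lipschitz function and its boundary is that graph.\<close>

definition lipschitz_boundary :: "(real^2) set \<Rightarrow> bool" where
  "lipschitz_boundary \<Omega> \<longleftrightarrow>
     (\<forall>p\<in>frontier \<Omega>. \<exists>e\<^sub>1 e\<^sub>2 \<phi> L r h.
        norm e\<^sub>1 = 1 \<and> norm e\<^sub>2 = 1 \<and> e\<^sub>1 \<bullet> e\<^sub>2 = 0 \<and> r > 0 \<and> h > 0 \<and>
        L-lipschitz_on {-r<..<r} \<phi> \<and> (\<forall>s\<in>{-r<..<r}. \<bar>\<phi> s\<bar> \<le> h / 2) \<and>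
        (\<forall>s\<in>{-r<..<r}. \<forall>t\<in>{-h<..<h}.
           (p + s *\<^sub>R e\<^sub>1 + t *\<^sub>R e\<^sub>2 \<in> \<Omega> \<longleftrightarrow> \<phi> s < t) \<and>
           (p + s *\<^sub>R e\<^sub>1 + t *\<^sub>R e\<^sub>2 \<in> frontier \<Omega> \<longleftrightarrow> t = \<phi> s)))"

definition L2 :: "(real^2) set \<Rightarrow> (real^2 \<Rightarrow> real) set" where
  "L2 S = {f. f \<in> borel_measurable (lebesgue_on S) \<and> integrable (lebesgue_on S) (\<lambda>x. (f x)\<^sup>2)}"

definition L2_inner :: "(real^2) set \<Rightarrow> (real^2 \<Rightarrow> real) \<Rightarrow> (real^2 \<Rightarrow> real) \<Rightarrow> real" where
  "L2_inner S f g = (LINT x:S|lebesgue. f x * g x)"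

definition L2_norm :: "(real^2) set \<Rightarrow> (real^2 \<Rightarrow> real) \<Rightarrow> real" where
  "L2_norm S f = sqrt (L2_inner S f f)"


section \<open>Meshes\<close>

definition triangle :: "(real^2) set \<Rightarrow> bool" where
  "triangle K \<longleftrightarrow> (\<exists>a b c. \<not> collinear {a, b, c} \<and> K = convex hull {a, b, c})"

definition rectangle :: "(real^2) set \<Rightarrow> bool" where
  "rectangle K \<longleftrightarrow>
     (\<exists>a u v. u \<noteq> 0 \<and> v \<noteq> 0 \<and> u \<bullet> v = 0 \<and> K = convex hull {a, a + u, a + v, a + u + v})"

text \<open>Cells are closed sets. Hanging nodes are not excluded.\<close>

definition mesh :: "(real^2) set \<Rightarrow> (real^2) set set \<Rightarrow> bool" where
  "mesh \<Omega> T \<longleftrightarrow>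
     finite T \<and> (\<forall>K\<in>T. triangle K \<or> rectangle K) \<and>
     pairwise (\<lambda>K K'. interior K \<inter> interior K' = {}) T \<and> \<Union>T = closure \<Omega>"

text \<open>The ratio of the diameter of a cell to that of some inscribed disc is at most \<open>\<kappa>\<close>.\<close>

definition shape_regular :: "real \<Rightarrow> (real^2) set set \<Rightarrow> bool" where
  "shape_regular \<kappa> T \<longleftrightarrow> (\<forall>K\<in>T. \<exists>z \<rho>. \<rho> > 0 \<and> cball z (\<rho> / 2) \<subseteq> K \<and> diameter K \<le> \<kappa> * \<rho>)"

definition interior_edges :: "(real^2) set set \<Rightarrow> (real^2) set set" where
  "interior_edges T = {K \<inter> K' | K K'. K \<in> T \<and> K' \<in> T \<and> K \<noteq> K' \<and> aff_dim (K \<inter> K') = 1}"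

text \<open>A boundary edge is a maximal segment in which a side of a cell meets \<open>\<partial>\<Omega>\<close>; if there are no
  hanging nodes, these are the sides contained in \<open>\<partial>\<Omega>\<close>.\<close>

definition boundary_edges :: "(real^2) set \<Rightarrow> (real^2) set set \<Rightarrow> (real^2) set set" where
  "boundary_edges \<Omega> T =
     {E. aff_dim E = 1 \<and> (\<exists>K\<in>T. \<exists>S. S edge_of K \<and> E \<in> components (S \<inter> frontier \<Omega>))}"

definition edges :: "(real^2) set \<Rightarrow> (real^2) set set \<Rightarrow> (real^2) set set" where
  "edges \<Omega> T = interior_edges T \<union> boundary_edges \<Omega> T"

text \<open>The labelling of the two cells at an interior edge as \<open>K\<^sub>+\<close> and \<open>K\<^sub>-\<close> is arbitrary, and no
  form below depends on it. On a boundary edge, \<open>plus_cell\<close> is the only cell containing the edge.\<close>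

definition plus_cell :: "(real^2) set set \<Rightarrow> (real^2) set \<Rightarrow> (real^2) set" where
  "plus_cell T E = (SOME K. K \<in> T \<and> E \<subseteq> K)"

definition neighbour :: "(real^2) set set \<Rightarrow> (real^2) set \<Rightarrow> (real^2) set \<Rightarrow> (real^2) set" where
  "neighbour T K E = (SOME K'. K' \<in> T \<and> K' \<noteq> K \<and> E = K \<inter> K')"

definition minus_cell :: "(real^2) set set \<Rightarrow> (real^2) set \<Rightarrow> (real^2) set" where
  "minus_cell T E = neighbour T (plus_cell T E) E"

text \<open>The unit outward normal to \<open>K\<close> along an edge \<open>E \<subseteq> \<partial>K\<close>. As \<open>K\<close> is convex, it is the unit
  vector whose half-plane through \<open>E\<close> contains \<open>K\<close>; the condition also makes it orthogonal to \<open>E\<close>.\<close>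

definition outward_normal :: "(real^2) set \<Rightarrow> (real^2) set \<Rightarrow> real^2" where
  "outward_normal K E = (THE n. norm n = 1 \<and> (\<forall>x\<in>E. \<forall>y\<in>K. n \<bullet> (y - x) \<le> 0))"

text \<open>Integral of \<open>g\<close> over the segment \<open>E\<close> with respect to arc length; it does not depend on the
  order in which the endpoints of \<open>E\<close> are chosen.\<close>

definition edge_integral :: "(real^2) set \<Rightarrow> (real^2 \<Rightarrow> real) \<Rightarrow> real" where
  "edge_integral E g =
     (let (a, b) = (SOME (a, b). E = closed_segment a b)
      in dist a b * (LINT t:{0..1}|lebesgue. g (linepath a b t)))"


section \<open>Discontinuous piecewise polynomials\<close>

definition P1 :: "(real^2 \<Rightarrow> real) set" where
  "P1 = {p. \<exists>a b c d. \<forall>x. p x = a + b * x $ 1 + c * x $ 2 + d * x $ 1 * x $ 2}"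

text \<open>Elements of \<open>L\<^sup>2(\<Omega>)\<close> are represented by functions; the values on the mesh skeleton, a null
  set, are arbitrary, so the restriction condition is imposed in the interior of each cell.\<close>

definition V_DG :: "(real^2) set \<Rightarrow> (real^2) set set \<Rightarrow> (real^2 \<Rightarrow> real) set" where
  "V_DG \<Omega> T = {v \<in> L2 \<Omega>. \<forall>K\<in>T. \<exists>p\<in>P1. \<forall>x\<in>interior K. v x = p x}"

definition grad :: "(real^2 \<Rightarrow> real) \<Rightarrow> real^2 \<Rightarrow> real^2" where
  "grad v x = (THE D. GDERIV v x :> D)"

text \<open>The trace from inside \<open>K\<close>, for scalar and vector fields. For \<open>v\<close> in \<open>V_DG\<close> the field \<open>grad v\<close>
  is the piecewise gradient in the interior of each cell, so \<open>trace K (grad v)\<close> is the trace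
  of \<open>\<nabla>\<^sub>h v\<close>.\<close>

definition trace :: "(real^2) set \<Rightarrow> (real^2 \<Rightarrow> 'b::t2_space) \<Rightarrow> real^2 \<Rightarrow> 'b" where
  "trace K w x = Lim (at x within interior K) w"

definition jump ::
  "(real^2) set set \<Rightarrow> (real^2) set \<Rightarrow> (real^2 \<Rightarrow> real) \<Rightarrow> real^2 \<Rightarrow> real" where
  "jump T E w x =
     (if E \<in> interior_edges T then trace (plus_cell T E) w x - trace (minus_cell T E) w x
      else trace (plus_cell T E) w x)"

text \<open>The trace on \<open>E \<subseteq> \<partial>K\<close> from outside \<open>K\<close>.\<close>

definition outer_trace ::
  "(real^2) set set \<Rightarrow> (real^2) set \<Rightarrow> (real^2) set \<Rightarrow> (real^2 \<Rightarrow> real) \<Rightarrow> real^2 \<Rightarrow> real" where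
  "outer_trace T K E u x =
     (if E \<in> interior_edges T then trace (neighbour T K E) u x else 0)"

definition DG_norm :: "(real^2) set \<Rightarrow> (real^2) set set \<Rightarrow> (real^2 \<Rightarrow> real) \<Rightarrow> real" where
  "DG_norm \<Omega> T v =
     sqrt ((\<Sum>K\<in>T. LINT x:K|lebesgue. (norm (grad v x))\<^sup>2)
         + (\<Sum>E\<in>edges \<Omega> T. edge_integral E (\<lambda>x. (jump T E v x)\<^sup>2)))"


section \<open>The discrete forms\<close>

definition a_DG :: "(real^2) set \<Rightarrow> (real^2) set set \<Rightarrow> real \<Rightarrow>
    (real^2 \<Rightarrow> real) \<Rightarrow> (real^2 \<Rightarrow> real) \<Rightarrow> real" where
  "a_DG \<Omega> T \<sigma> u v =
     (\<Sum>K\<in>T. LINT x:K|lebesgue. grad u x \<bullet> grad v x)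
   + (\<Sum>E\<in>interior_edges T.
        let Kp = plus_cell T E; Km = minus_cell T E; np = outward_normal Kp E
        in edge_integral E (\<lambda>x.
             \<sigma> / diameter E * jump T E u x * jump T E v x
           - 1/2 * ((trace Kp (grad u) x + trace Km (grad u) x) \<bullet> np) * jump T E v x
           - 1/2 * ((trace Kp (grad v) x + trace Km (grad v) x) \<bullet> np) * jump T E u x))
   + (\<Sum>E\<in>boundary_edges \<Omega> T.
        let K = plus_cell T E; n = outward_normal K E
        in edge_integral E (\<lambda>x.
             2 * \<sigma> / diameter E * trace K u x * trace K v x
           - (trace K (grad u) x \<bullet> n) * trace K v x
           - (trace K (grad v) x \<bullet> n) * trace K u x))"

text \<open>The integral over \<open>\<partial>K\<close> is the sum over the edges contained in \<open>K\<close>, which tile \<open>\<partial>K\<close>.\<close>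

definition b_DG :: "(real^2) set \<Rightarrow> (real^2) set set \<Rightarrow> (real^2 \<Rightarrow> real^2) \<Rightarrow>
    (real^2 \<Rightarrow> real) \<Rightarrow> (real^2 \<Rightarrow> real) \<Rightarrow> real" where
  "b_DG \<Omega> T w u v =
     (\<Sum>K\<in>T. LINT x:K|lebesgue. (w x \<bullet> grad u x) * v x)
   + (\<Sum>K\<in>T. 1/2 * (\<Sum>E | E \<in> edges \<Omega> T \<and> E \<subseteq> K.
        let n = outward_normal K E
        in edge_integral E (\<lambda>x.
             ((trace K w x \<bullet> n) * (outer_trace T K E u x - trace K u x)
              - \<bar>trace K w x \<bullet> n\<bar> * (outer_trace T K E u x - trace K u x)) * trace K v x)))"

definition dpow :: "real \<Rightarrow> real \<Rightarrow> real" where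
  "dpow \<delta> s = (if \<delta> \<in> \<int> then s powi \<lfloor>\<delta>\<rfloor> else \<bar>s\<bar> powr \<delta>)"

definition A_DG :: "(real^2) set \<Rightarrow> (real^2) set set \<Rightarrow> real \<Rightarrow>
    real \<Rightarrow> real \<Rightarrow> real \<Rightarrow> real \<Rightarrow> real \<Rightarrow>
    (real^2 \<Rightarrow> real) \<Rightarrow> (real^2 \<Rightarrow> real) \<Rightarrow> real" where
  "A_DG \<Omega> T \<sigma> \<nu> \<alpha> \<beta> \<gamma> \<delta> v \<eta> =
     \<nu> * a_DG \<Omega> T \<sigma> v \<eta>
   + \<alpha> * b_DG \<Omega> T (\<lambda>x. vector [dpow \<delta> (v x), dpow \<delta> (v x)]) v \<eta>
   - \<beta> * L2_inner \<Omega> (\<lambda>x. v x * (1 - dpow \<delta> (v x)) * (dpow \<delta> (v x) - \<gamma>)) \<eta>"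

end

theory Submission
  imports Defs "HOL-Homology.Brouwer_Degree"
begin

text \<open>In \<open>A_DG v v\<close> the reaction term contributes \<open>\<beta> \<integral> v\<^sup>2 (v\<^sup>\<delta>)\<^sup>2\<close>, which is homogeneous of degree
  \<open>2 \<delta> + 2\<close> and positive for \<open>v \<noteq> 0\<close>, whereas all other terms of \<open>A_DG v v - (f, v)\<close> have degree at
  most \<open>\<delta> + 2\<close>. As \<open>V_DG\<close> is finite-dimensional, the degree \<open>2 \<delta> + 2\<close> term dominates on a sphere of
  large radius in coefficient space. There the field \<open>v \<mapsto> A_DG v - (f, _)\<close> points outwards, so it
  vanishes somewhere. The dimension depends on the mesh and is not a type, so the topological
  argument takes place in \<open>nat \<Rightarrow> real\<close>, with the non-contractibility of \<open>nsphere\<close> in place of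
  Brouwer's theorem.\<close>

section \<open>Zeros of outward-pointing fields\<close>

text \<open>The forms see the elements of \<open>V_DG\<close> through \<open>Lim\<close>,
  \<open>THE\<close> and \<open>SOME\<close>: traces, gradients, neighbouring cells, endpoints of
  edges. None of these is visibly continuous in the coefficients. Each integrand is therefore first
  matched, on the set where it counts, with an expression in the coefficients that is continuous
  everywhere. Predicates on such fields, closed under sums, products, \<open>abs\<close> and
  \<open>dpow\<close>, then let the degree of a term be read off its syntax. The modulus in the
  upwind term and \<open>dpow\<close> for non-integer \<delta> make the forms non-polynomial. What
  survives is continuity, and homogeneity of real degree under positive scaling, which is exactly
  what a comparison on a large sphere requires. Positivity of the top term rests on a square: on the
  diagonal its integrand is (v v^\<delta>)^2, and one non-zero coefficient makes v non-zero on an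
  open subset of the domain.\<close>

definition unit_vec :: "nat \<Rightarrow> nat \<Rightarrow> real" where
  "unit_vec i j = (if j = i then 1 else 0)"

text \<open>The coordinates run from 0 to n, so this is the n-dimensional sphere in n + 1 variables.
  The zero padding makes it literally the carrier of \<open>nsphere\<close>.\<close>

definition coord_sphere :: "nat \<Rightarrow> (nat \<Rightarrow> real) set" where
  "coord_sphere n = {x. (\<Sum>i\<le>n. (x i)\<^sup>2) = 1 \<and> (\<forall>i>n. x i = 0)}"

lemma nsphere_eq_coord_sphere: "nsphere n = top_of_set (coord_sphere n)"
  by (simp add: nsphere coord_sphere_def euclidean_product_topology)

lemma not_contractible_coord_sphere: "\<not> contractible (coord_sphere n)"
  using non_contractible_space_nsphere[of n]
  by (simp add: nsphere_eq_coord_sphere)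

text \<open>The three shapes are the domains met later: coefficient space itself, homotopy time
  paired with it, and coefficient space paired with a point of an integration domain.\<close>

lemma continuous_on_coordinate [continuous_intros]:
  fixes S :: "(nat \<Rightarrow> real) set" and S' :: "('a::topological_space \<times> (nat \<Rightarrow> real)) set"
    and S'' :: "((nat \<Rightarrow> real) \<times> 'b::topological_space) set"
  shows "continuous_on S (\<lambda>x. x i)"
    and "continuous_on S' (\<lambda>z. snd z i)"
    and "continuous_on S'' (\<lambda>z. fst z i)"
  by (rule continuous_on_product_then_coordinatewise; intro continuous_intros)+

text \<open>Radial projection in the first n + 1 coordinates. Cutting off the tail matters because
  the fields to be projected may have arbitrary entries beyond n.\<close>

definition normalize_to :: "nat \<Rightarrow> (nat \<Rightarrow> real) \<Rightarrow> nat \<Rightarrow> real" where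
  "normalize_to n y = (\<lambda>i. if i \<le> n then y i / sqrt (\<Sum>j\<le>n. (y j)\<^sup>2) else 0)"

lemma normalize_to_in_sphere:
  assumes "\<exists>i\<le>n. y i \<noteq> 0"
  shows "normalize_to n y \<in> coord_sphere n"
proof -
  have "(\<Sum>j\<le>n. (y j)\<^sup>2) > 0"
    using assms by (auto intro!: sum_pos2)
  then show ?thesis
    by (auto simp: coord_sphere_def normalize_to_def power_divide simp flip: sum_divide_distrib)
qed

lemma normalize_to_id: "x \<in> coord_sphere n \<Longrightarrow> normalize_to n x = x"
  by (auto simp: coord_sphere_def normalize_to_def)

lemma continuous_on_normalize_to:
  fixes g :: "'a::topological_space \<Rightarrow> nat \<Rightarrow> real"
  assumes g: "\<And>i. i \<le> n \<Longrightarrow> continuous_on S (\<lambda>x. g x i)"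
    and nz: "\<And>x. x \<in> S \<Longrightarrow> \<exists>i\<le>n. g x i \<noteq> 0"
  shows "continuous_on S (\<lambda>x. normalize_to n (g x))"
proof (rule continuous_on_coordinatewise_then_product)
  fix i
  have "(\<Sum>j\<le>n. (g x j)\<^sup>2) > 0" if "x \<in> S" for x
    using nz[OF that] by (auto intro!: sum_pos2)
  then have "\<forall>x\<in>S. sqrt (\<Sum>j\<le>n. (g x j)\<^sup>2) \<noteq> 0"
    by (metis less_irrefl real_sqrt_eq_zero_cancel_iff)
  then show "continuous_on S (\<lambda>x. normalize_to n (g x) i)"
    unfolding normalize_to_def
    by (cases "i \<le> n") (auto intro!: continuous_intros g)
qed

text \<open>Radial projection is continuous away from the origin, so a deformation that never
  vanishes in its first n + 1 coordinates becomes a homotopy within the sphere.\<close>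

lemma homotopic_normalize_to:
  fixes g :: "real \<Rightarrow> (nat \<Rightarrow> real) \<Rightarrow> nat \<Rightarrow> real"
  assumes g: "\<And>i. i \<le> n \<Longrightarrow> continuous_on ({0..1} \<times> S) (\<lambda>z. g (fst z) (snd z) i)"
    and nz: "\<And>t x. t \<in> {0..1} \<Longrightarrow> x \<in> S \<Longrightarrow> \<exists>i\<le>n. g t x i \<noteq> 0"
    and p: "\<And>x. x \<in> S \<Longrightarrow> normalize_to n (g 0 x) = p x"
    and q: "\<And>x. x \<in> S \<Longrightarrow> normalize_to n (g 1 x) = q x"
  shows "homotopic_with_canon (\<lambda>_. True) S (coord_sphere n) p q"
proof -
  let ?h = "\<lambda>z. normalize_to n (g (fst z) (snd z))"
  have "continuous_on ({0..1} \<times> S) ?h"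
    by (rule continuous_on_normalize_to) (use g nz in auto)
  then show ?thesis
    by (subst homotopic_with)
       (auto intro!: exI[of _ ?h] simp: p q normalize_to_in_sphere nz)
qed

text \<open>If \<open>F\<close> had no zero, \<open>(t, x) \<mapsto> F (t R x) / |F (t R x)|\<close> would contract the map
  \<open>x \<mapsto> F (R x) / |F (R x)|\<close> of the sphere, which is homotopic to the identity
  because \<open>F (R x)\<close> never points opposite to \<open>x\<close>.\<close>

lemma exists_zero_of_outward_pointing:
  fixes F :: "(nat \<Rightarrow> real) \<Rightarrow> nat \<Rightarrow> real"
  assumes cont: "\<And>i. i \<le> n \<Longrightarrow> continuous_on UNIV (\<lambda>x. F x i)"
    and out: "\<And>x. x \<in> coord_sphere n \<Longrightarrow> (\<Sum>i\<le>n. F (\<lambda>i. R * x i) i * x i) > 0"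
  shows "\<exists>x. \<forall>i\<le>n. F x i = 0"
proof (rule ccontr)
  assume "\<not> ?thesis"
  then have nz: "\<And>x. \<exists>i\<le>n. F x i \<noteq> 0" by blast
  let ?S = "coord_sphere n"
  have cF: "continuous_on S (\<lambda>z. F (\<lambda>j. g z * snd z j) i)"
    if "i \<le> n" "continuous_on S g" for i S and g :: "real \<times> (nat \<Rightarrow> real) \<Rightarrow> real"
    by (rule continuous_on_compose2[OF cont[OF that(1)]])
       (auto intro!: continuous_intros continuous_on_coordinatewise_then_product that)
  have 1: "homotopic_with_canon (\<lambda>_. True) ?S ?S
      (\<lambda>x. normalize_to n (F (\<lambda>i. 0))) (\<lambda>x. normalize_to n (F (\<lambda>i. R * x i)))"
    by (rule homotopic_normalize_to[of n _ "\<lambda>t x. F (\<lambda>i. (t * R) * x i)"])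
       (auto intro!: cF continuous_intros nz)
  have 2: "homotopic_with_canon (\<lambda>_. True) ?S ?S id (\<lambda>x. normalize_to n (F (\<lambda>i. R * x i)))"
  proof (rule homotopic_normalize_to[of n _ "\<lambda>t x i. (1 - t) * x i + t * F (\<lambda>i. R * x i) i"])
    fix t :: real and x assume t: "t \<in> {0..1}" and x: "x \<in> ?S"
    \<comment> \<open>Pairing with x reduces avoidance of the origin to positivity of a convex
      combination of 1 and a positive number.\<close>
    have "(\<Sum>i\<le>n. ((1 - t) * x i + t * F (\<lambda>i. R * x i) i) * x i)
        = (1 - t) * (\<Sum>i\<le>n. (x i)\<^sup>2) + t * (\<Sum>i\<le>n. F (\<lambda>i. R * x i) i * x i)"
      by (simp add: sum_distrib_left algebra_simps power2_eq_square flip: sum.distrib)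
    also have "\<dots> = (1 - t) + t * (\<Sum>i\<le>n. F (\<lambda>i. R * x i) i * x i)"
      using x by (simp add: coord_sphere_def)
    also have "\<dots> > 0"
      using t out[OF x] by (cases "t = 1") (auto intro!: add_pos_nonneg)
    finally show "\<exists>i\<le>n. (1 - t) * x i + t * F (\<lambda>i. R * x i) i \<noteq> 0"
      by (metis (mono_tags, lifting) atMost_iff less_irrefl mult_zero_left sum.neutral)
  qed (auto intro!: continuous_intros cF simp: normalize_to_id)
  have "contractible ?S"
    unfolding contractible_def
    using homotopic_with_trans[OF 2 homotopic_with_symD[OF 1]] by blast
  then show False
    using not_contractible_coord_sphere by blast
qed

section \<open>Equations dominated by their term of highest degree\<close>

definition linear_coords :: "((nat \<Rightarrow> real) \<Rightarrow> real) \<Rightarrow> bool" where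
  "linear_coords L \<longleftrightarrow> (\<forall>s d d'. L (\<lambda>i. s * d i + d' i) = s * L d + L d')"

lemma linear_coordsD: "linear_coords L \<Longrightarrow> L (\<lambda>i. s * d i + d' i) = s * L d + L d'"
  by (simp add: linear_coords_def)

lemma linear_coords_0: "linear_coords L \<Longrightarrow> L (\<lambda>i. 0) = 0"
  \<comment> \<open>For s = -1 and zero arguments the right-hand side cancels.\<close>
  using linear_coordsD[of L "-1" "\<lambda>i. 0" "\<lambda>i. 0"] by simp

lemma linear_coords_scale: "linear_coords L \<Longrightarrow> L (\<lambda>i. s * d i) = s * L d"
  using linear_coordsD[of L s d "\<lambda>i. 0"] linear_coords_0[of L] by simp

text \<open>Finite support is essential: a linear functional on all sequences need not be determined
  by its values on unit vectors. Truncations of d are built up one coordinate at a time.\<close>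

lemma linear_coords_expand:
  assumes L: "linear_coords L" and d: "\<And>i. i > n \<Longrightarrow> d i = 0"
  shows "L d = (\<Sum>i\<le>n. d i * L (unit_vec i))"
proof -
  have "L (\<lambda>i. if i < k then d i else 0) = (\<Sum>i<k. d i * L (unit_vec i))" for k
  proof (induction k)
    case 0
    then show ?case using linear_coords_0[OF L] by simp
  next
    case (Suc k)
    have "(\<lambda>i. if i < Suc k then d i else 0)
        = (\<lambda>i. d k * unit_vec k i + (if i < k then d i else 0))"
      by (auto simp: unit_vec_def fun_eq_iff less_Suc_eq)
    then show ?case
      using Suc linear_coordsD[OF L, of "d k" "unit_vec k"] by simp
  qed
  from this[of "Suc n"] have "L (\<lambda>i. if i \<le> n then d i else 0) = (\<Sum>i\<le>n. d i * L (unit_vec i))"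
    by (simp add: less_Suc_eq_le lessThan_Suc_atMost)
  moreover have "(\<lambda>i. if i \<le> n then d i else 0) = d"
    using d by (auto simp: fun_eq_iff)
  ultimately show ?thesis by simp
qed

text \<open>c stands for the coefficients of the unknown and d for those of the test function.
  Continuity is asked for each fixed d only; linearity in d recovers it on the diagonal. The scaling
  r is positive because \<open>abs\<close> and \<open>dpow\<close> respect no other scaling in
  general.\<close>

definition homogeneous_form :: "real \<Rightarrow> ((nat \<Rightarrow> real) \<Rightarrow> (nat \<Rightarrow> real) \<Rightarrow> real) \<Rightarrow> bool" where
  "homogeneous_form p Q \<longleftrightarrow>
     (\<forall>c. linear_coords (Q c)) \<and> (\<forall>d. continuous_on UNIV (\<lambda>c. Q c d)) \<and>
     (\<forall>r>0. \<forall>c d. Q (\<lambda>i. r * c i) d = r powr p * Q c d)"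

text \<open>Tychonoff: the sphere is closed in the product topology and lies in the compact cube of
  sequences with entries between -1 and 1.\<close>

lemma compact_coord_sphere: "compact (coord_sphere n)"
proof -
  have "compactin (product_topology (\<lambda>i. euclidean) UNIV) (PiE UNIV (\<lambda>i::nat. {-1..1::real}))"
    by (subst compactin_PiE) auto
  then have 1: "compact (PiE UNIV (\<lambda>i::nat. {-1..1::real}))"
    by (simp add: euclidean_product_topology)
  have "closed {x. (\<Sum>i\<le>n. (x i)\<^sup>2) = (1::real)}"
    by (intro closed_Collect_eq continuous_intros)
  moreover have "closed {x. \<forall>i>n. x i = (0::real)}"
    by (intro closed_Collect_all closed_Collect_imp closed_Collect_eq continuous_intros) auto
  ultimately have 2: "closed (coord_sphere n)"
    unfolding coord_sphere_def Collect_conj_eq by (rule closed_Int)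
  have "coord_sphere n \<subseteq> PiE UNIV (\<lambda>i::nat. {-1..1::real})"
  proof
    fix x assume x: "x \<in> coord_sphere n"
    have "\<bar>x i\<bar> \<le> 1" for i
    proof (cases "i \<le> n")
      case True
      then have "(x i)\<^sup>2 \<le> (\<Sum>i\<le>n. (x i)\<^sup>2)"
        by (intro member_le_sum) auto
      then show ?thesis
        using x by (simp add: coord_sphere_def abs_square_le_1)
    qed (use x in \<open>auto simp: coord_sphere_def\<close>)
    then show "x \<in> PiE UNIV (\<lambda>i::nat. {-1..1::real})"
      by (auto simp: abs_le_iff minus_le_iff)
  qed
  then show ?thesis
    using compact_Int_closed[OF 1 2] by (simp add: Int_absorb1)
qed

lemma unit_vec_in_sphere: "unit_vec 0 \<in> coord_sphere n"
  by (auto simp: coord_sphere_def unit_vec_def power2_eq_square if_distrib[of "\<lambda>x. x * _"] cong: if_cong)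

text \<open>On the sphere the second argument expands into finitely many unit vectors, which reduces
  continuity to fixed second arguments. Linearity in that argument raises the degree by one.\<close>

lemma homogeneous_form_diag:
  assumes Q: "homogeneous_form p Q"
  shows "continuous_on (coord_sphere n) (\<lambda>c. Q c c)"
    and "r > 0 \<Longrightarrow> Q (\<lambda>i. r * c i) (\<lambda>i. r * c i) = r powr (p + 1) * Q c c"
proof -
  have lin: "linear_coords (Q c)" for c
    using Q by (auto simp: homogeneous_form_def)
  have "Q c c = (\<Sum>i\<le>n. c i * Q c (unit_vec i))" if "c \<in> coord_sphere n" for c
    using that by (intro linear_coords_expand[OF lin]) (auto simp: coord_sphere_def)
  moreover have "continuous_on (coord_sphere n) (\<lambda>c. \<Sum>i\<le>n. c i * Q c (unit_vec i))"
    using Q by (intro continuous_intros) (auto simp: homogeneous_form_def intro: continuous_on_subset)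
  ultimately show "continuous_on (coord_sphere n) (\<lambda>c. Q c c)"
    by (simp cong: continuous_on_cong)
  show "Q (\<lambda>i. r * c i) (\<lambda>i. r * c i) = r powr (p + 1) * Q c c" if "r > 0"
    using Q that linear_coords_scale[OF lin] by (simp add: homogeneous_form_def powr_add)
qed

text \<open>Let m be the minimum of the diagonal of Q2 on the unit sphere, and let M, M0, M1 bound l
  and the diagonals of Q0 and Q1 there. For R \<ge> 1 the residual at R c, paired with R c, is at
  least R^(p1 + 1) (m R^(p2 - p1) - M - M0 - M1), so for large R the residual points
  outwards.\<close>

lemma homogeneous_form_solvable:
  assumes Q0: "homogeneous_form p0 Q0" and Q1: "homogeneous_form p1 Q1"
    and Q2: "homogeneous_form p2 Q2" and p: "p0 \<le> p1" "0 \<le> p1" "p1 < p2"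
    and pos: "\<And>c. c \<in> coord_sphere n \<Longrightarrow> Q2 c c > 0"
    and l: "linear_coords l"
  shows "\<exists>c. \<forall>d. (\<forall>i>n. d i = 0) \<longrightarrow> Q0 c d + Q1 c d + Q2 c d = l d"
proof -
  let ?S = "coord_sphere n"
  have bound: "\<exists>M. \<forall>c\<in>?S. \<bar>g c\<bar> \<le> M" if "continuous_on ?S g" for g :: "(nat \<Rightarrow> real) \<Rightarrow> real"
    using compact_imp_bounded[OF compact_continuous_image[OF that compact_coord_sphere]]
    by (auto simp: bounded_iff)
  have l_eq: "l c = (\<Sum>i\<le>n. c i * l (unit_vec i))" if "c \<in> ?S" for c
    using that by (intro linear_coords_expand[OF l]) (auto simp: coord_sphere_def)
  have "continuous_on ?S (\<lambda>c. \<Sum>i\<le>n. c i * l (unit_vec i))"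
    by (intro continuous_intros)
  then have "continuous_on ?S l"
    using l_eq by (simp cong: continuous_on_cong)
  then obtain M where M: "\<And>c. c \<in> ?S \<Longrightarrow> \<bar>l c\<bar> \<le> M"
    using bound by blast
  obtain M0 where M0: "\<And>c. c \<in> ?S \<Longrightarrow> \<bar>Q0 c c\<bar> \<le> M0"
    using bound homogeneous_form_diag(1)[OF Q0] by blast
  obtain M1 where M1: "\<And>c. c \<in> ?S \<Longrightarrow> \<bar>Q1 c c\<bar> \<le> M1"
    using bound homogeneous_form_diag(1)[OF Q1] by blast
  obtain z where z: "z \<in> ?S" "\<And>c. c \<in> ?S \<Longrightarrow> Q2 z z \<le> Q2 c c"
    using continuous_attains_inf[OF compact_coord_sphere _ homogeneous_form_diag(1)[OF Q2]]
      unit_vec_in_sphere by blast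
  define m where "m = Q2 z z"
  have m: "m > 0" using pos[OF z(1)] by (simp add: m_def)
  have nn: "0 \<le> M" "0 \<le> M0" "0 \<le> M1"
    using M[OF z(1)] M0[OF z(1)] M1[OF z(1)] by linarith+
  \<comment> \<open>This choice gives m B = M + M0 + M1 + m as well as B \<ge> 1.\<close>
  define B where "B = (M + M0 + M1) / m + 1"
  have B: "B \<ge> 1" "m * B > M + M0 + M1"
    using m nn by (auto simp: B_def field_simps)
  \<comment> \<open>The solution of R^(p2 - p1) = B. From B \<ge> 1 follows R \<ge> 1, so that the
    powers with exponents p0 + 1 and 1 are dominated by the one with exponent p1 + 1.\<close>
  define R where "R = B powr (1 / (p2 - p1))"
  have R: "R \<ge> 1" using B p by (simp add: R_def ge_one_powr_ge_zero)
  have RB: "R powr (p2 - p1) = B"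
    using B p by (simp add: R_def powr_powr)
  have "R powr (p2 + 1) = R powr (p1 + 1) * R powr (p2 - p1)"
    by (simp add: add.commute flip: powr_add)
  then have R2: "R powr (p2 + 1) = R powr (p1 + 1) * B"
    by (simp add: RB)
  have R1: "R powr (p0 + 1) \<le> R powr (p1 + 1)" "R \<le> R powr (p1 + 1)"
    using R p powr_mono[of 1 "p1 + 1" R] by (auto intro!: powr_mono)
  \<comment> \<open>The residual tested with unit vectors. By linearity, a zero in the first n + 1
    entries settles every test vector supported there.\<close>
  define F where "F = (\<lambda>c i. Q0 c (unit_vec i) + Q1 c (unit_vec i) + Q2 c (unit_vec i) - l (unit_vec i))"
  have lin: "linear_coords (\<lambda>d. Q0 c d + Q1 c d + Q2 c d - l d)" for c
    using Q0 Q1 Q2 l by (auto simp: homogeneous_form_def linear_coords_def algebra_simps)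
  have F: "Q0 c d + Q1 c d + Q2 c d - l d = (\<Sum>i\<le>n. F c i * d i)" if "\<forall>i>n. d i = 0" for c d
    using that linear_coords_expand[OF lin, of n d c] by (simp add: F_def mult.commute)
  have "\<exists>c. \<forall>i\<le>n. F c i = 0"
  proof (rule exists_zero_of_outward_pointing)
    show "continuous_on UNIV (\<lambda>c. F c i)" for i
      using Q0 Q1 Q2 unfolding F_def homogeneous_form_def
      by (intro continuous_intros) auto
    fix c assume c: "c \<in> ?S"
    let ?c = "\<lambda>i. R * c i"
    have "Q0 ?c ?c \<ge> - (R powr (p1 + 1) * M0)"
    proof -
      have "\<bar>Q0 ?c ?c\<bar> \<le> R powr (p1 + 1) * M0"
        using R R1 M0[OF c] homogeneous_form_diag(2)[OF Q0]
        by (simp add: abs_mult mult_mono)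
      then show ?thesis by linarith
    qed
    moreover have "Q1 ?c ?c \<ge> - (R powr (p1 + 1) * M1)"
    proof -
      have "\<bar>Q1 ?c ?c\<bar> \<le> R powr (p1 + 1) * M1"
        using R R1 M1[OF c] homogeneous_form_diag(2)[OF Q1]
        by (simp add: abs_mult mult_mono)
      then show ?thesis by linarith
    qed
    moreover have "l ?c \<le> R powr (p1 + 1) * M"
    proof -
      have "\<bar>l ?c\<bar> \<le> R powr (p1 + 1) * M"
        using R R1 M[OF c] linear_coords_scale[OF l]
        by (simp add: abs_mult mult_mono)
      then show ?thesis by linarith
    qed
    moreover have "Q2 ?c ?c \<ge> R powr (p1 + 1) * B * m"
      using R R2 z(2)[OF c] B homogeneous_form_diag(2)[OF Q2]
      by (simp add: m_def mult_left_mono)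
    ultimately have "R powr (p1 + 1) * (m * B - (M + M0 + M1)) \<le> Q0 ?c ?c + Q1 ?c ?c + Q2 ?c ?c - l ?c"
      by (simp add: algebra_simps)
    moreover have "0 < R powr (p1 + 1) * (m * B - (M + M0 + M1))"
      using R B by simp
    ultimately have "0 < (\<Sum>i\<le>n. F ?c i * ?c i)"
      using F[of ?c ?c] c by (simp add: coord_sphere_def)
    \<comment> \<open>The outward condition pairs with the unit vector c and not with R c.\<close>
    also have "(\<Sum>i\<le>n. F ?c i * ?c i) = R * (\<Sum>i\<le>n. F ?c i * c i)"
      by (simp add: sum_distrib_left algebra_simps)
    finally show "(\<Sum>i\<le>n. F ?c i * c i) > 0"
      using R by (simp add: zero_less_mult_iff)
  qed
  then obtain c where "\<forall>i\<le>n. F c i = 0" ..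
  then show ?thesis
    using F by (intro exI[of _ c]) (simp add: algebra_simps)
qed

section \<open>Integrals, traces and gradients\<close>

text \<open>Completeness of Lebesgue measure: the preimages under f and g differ only inside N, and
  every subset of N is measurable.\<close>

lemma borel_measurable_lebesgue_spike:
  fixes f g :: "'a::euclidean_space \<Rightarrow> real"
  assumes N: "negligible N" and eq: "\<And>x. x \<notin> N \<Longrightarrow> f x = g x" and g: "g \<in> borel_measurable lebesgue"
  shows "f \<in> borel_measurable lebesgue"
proof (rule measurableI)
  fix A :: "real set" assume "A \<in> sets borel"
  then have "g -` A \<in> sets lebesgue"
    using measurable_sets[OF g] by simp
  moreover have "N \<in> sets lebesgue" using N by (rule negligible_imp_sets)
  moreover have "f -` A \<inter> N \<in> sets lebesgue"
    using N by (auto intro: negligible_imp_sets negligible_subset)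
  moreover have "f -` A = (g -` A - N) \<union> (f -` A \<inter> N)"
    using eq by auto
  ultimately have "f -` A \<in> sets lebesgue"
    by (metis sets.Diff sets.Un)
  then show "f -` A \<inter> space lebesgue \<in> sets lebesgue"
    by simp
qed simp

text \<open>Nothing is known about f on N. This suits integrands such as those built from
  \<open>grad v\<close>, which are arbitrary on the mesh skeleton.\<close>

lemma lebesgue_spike:
  fixes f g :: "'a::euclidean_space \<Rightarrow> real"
  assumes N: "negligible N" and eq: "\<And>x. x \<in> S - N \<Longrightarrow> f x = g x"
    and g: "set_integrable lebesgue S g"
  shows "set_integrable lebesgue S f" "(LINT x:S|lebesgue. f x) = (LINT x:S|lebesgue. g x)"
proof -
  let ?f = "\<lambda>x. indicator S x *\<^sub>R f x" and ?g = "\<lambda>x. indicator S x *\<^sub>R g x"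
  have g': "?g \<in> borel_measurable lebesgue" "integrable lebesgue ?g"
    using g by (auto simp: set_integrable_def)
  have eq': "?f x = ?g x" if "x \<notin> N" for x
    using that eq by (auto simp: indicator_def)
  have f': "?f \<in> borel_measurable lebesgue"
    using borel_measurable_lebesgue_spike[OF N eq' g'(1)] .
  have "AE x in lebesgue. ?f x = ?g x"
    using N eq' unfolding negligible_iff_null_sets
    by (intro AE_I'[of N]) auto
  then show "set_integrable lebesgue S f" "(LINT x:S|lebesgue. f x) = (LINT x:S|lebesgue. g x)"
    using integrable_cong_AE[OF f' g'(1)] integral_cong_AE[OF f' g'(1)] g'(2)
    by (auto simp: set_integrable_def set_lebesgue_integral_def)
qed

lemma set_integrable_continuous_bounded:
  fixes g :: "'a::euclidean_space \<Rightarrow> real"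
  assumes "continuous_on UNIV g" "S \<in> sets lebesgue" "bounded S"
  shows "set_integrable lebesgue S g"
proof -
  have "integrable lborel (\<lambda>x. indicator (closure S) x *\<^sub>R g x)"
    using assms by (intro borel_integrable_compact) (auto intro: continuous_on_subset simp: compact_closure)
  then have "set_integrable lebesgue (closure S) g"
    unfolding set_integrable_def by (subst integrable_completion) auto
  then show ?thesis
    by (rule set_integrable_subset) (use assms closure_subset in auto)
qed

text \<open>The parameter space is an arbitrary topological space, so the argument is not
  sequential: compactness of the closure of S yields one neighbourhood of c0 in which the integrands
  differ by at most \<open>\<epsilon>\<close> on all of S.\<close>

lemma continuous_on_parametric_integral:
  fixes G :: "'c::topological_space \<Rightarrow> 'a::euclidean_space \<Rightarrow> real"
  assumes G: "continuous_on UNIV (\<lambda>z. G (fst z) (snd z))"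
    and S: "S \<in> sets lebesgue" "bounded S"
  shows "continuous_on UNIV (\<lambda>c. LINT x:S|lebesgue. G c x)"
proof -
  have Gc: "continuous_on UNIV (G c)" for c
    using continuous_on_compose2[OF G, of UNIV "\<lambda>x. (c, x)"] by (simp add: continuous_intros)
  have int: "set_integrable lebesgue S (G c)" for c
    by (rule set_integrable_continuous_bounded[OF Gc S])
  have Sm: "S \<in> lmeasurable"
    using S by (simp add: bounded_set_imp_lmeasurable)
  show ?thesis
    unfolding continuous_on_def
  proof (intro ballI tendstoI)
    fix c0 :: 'c and e :: real assume e: "e > 0"
    define m where "m = measure lebesgue S"
    \<comment> \<open>The added 1 covers sets of measure zero.\<close>
    define \<epsilon> where "\<epsilon> = e / (2 * (m + 1))"
    have m: "m \<ge> 0" by (simp add: m_def)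
    have \<epsilon>: "\<epsilon> > 0" "\<epsilon> * m < e"
      using e m mult_nonneg_nonneg[of e m] by (auto simp: \<epsilon>_def field_simps intro!: add_nonneg_pos)
    have G': "continuous_on (UNIV \<times> closure S) (\<lambda>z. G (fst z) (snd z))"
      using G by (rule continuous_on_subset) simp
    have "compact (closure S)" using S by (simp add: compact_closure)
    then obtain X where X: "c0 \<in> X" "open X"
      and close: "\<forall>c\<in>X \<inter> UNIV. \<forall>x\<in>closure S. dist (G (fst (c, x)) (snd (c, x))) (G (fst (c0, x)) (snd (c0, x))) \<le> \<epsilon>"
      by (rule continuous_on_prod_compactE[OF G' _ UNIV_I \<epsilon>(1), of c0])
    have "dist (LINT x:S|lebesgue. G c x) (LINT x:S|lebesgue. G c0 x) < e" if "c \<in> X" for c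
    proof -
      have "(LINT x:S|lebesgue. G c x) - (LINT x:S|lebesgue. G c0 x) = (LINT x:S|lebesgue. G c x - G c0 x)"
        using int by (simp add: set_integral_diff)
      also have "\<bar>\<dots>\<bar> \<le> (LINT x:S|lebesgue. \<bar>G c x - G c0 x\<bar>)"
        using set_integral_norm_bound[OF set_integral_diff(1)[OF int int]] by simp
      also have "\<dots> \<le> (LINT x:S|lebesgue. \<epsilon>)"
      proof (rule set_integral_mono)
        show "set_integrable lebesgue S (\<lambda>x. \<bar>G c x - G c0 x\<bar>)"
          using set_integral_diff(1)[OF int int] by (rule set_integrable_abs)
        show "set_integrable lebesgue S (\<lambda>x. \<epsilon>)"
          by (rule set_integrable_continuous_bounded[OF _ S]) simp
        show "\<bar>G c x - G c0 x\<bar> \<le> \<epsilon>" if "x \<in> S" for x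
          using close \<open>c \<in> X\<close> that closure_subset[of S] by (auto simp: dist_real_def)
      qed
      also have "\<dots> = \<epsilon> * m"
        using Sm by (simp add: set_lebesgue_integral_def m_def)
      finally show ?thesis using \<epsilon> by (simp add: dist_real_def)
    qed
    then show "\<forall>\<^sub>F c in at c0 within UNIV. dist (LINT x:S|lebesgue. G c x) (LINT x:S|lebesgue. G c0 x) < e"
      using X unfolding eventually_at_topological by blast
  qed
qed

text \<open>A closed convex set with interior points is the closure of its interior. Hence
  \<open>Lim\<close> is taken along a non-trivial filter, and its value is that of the continuous
  extension p.\<close>

lemma trace_eq:
  fixes p v :: "real^2 \<Rightarrow> 'b::t2_space"
  assumes K: "convex K" "closed K" "interior K \<noteq> {}" and x: "x \<in> K"
    and p: "continuous_on UNIV p" and eq: "\<And>y. y \<in> interior K \<Longrightarrow> v y = p y"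
  shows "trace K v x = p x"
  unfolding trace_def
proof (rule tendsto_Lim)
  have "closure (interior K) = K"
    using K by (simp add: convex_closure_interior)
  then have "x islimpt interior K"
    using x interior_limit_point[of x "interior K"] by (auto simp: closure_def)
  then show "\<not> trivial_limit (at x within interior K)"
    by (simp add: trivial_limit_within)
  have "isCont p x"
    using p by (simp add: continuous_on_eq_continuous_at)
  then have "(p \<longlongrightarrow> p x) (at x within interior K)"
    unfolding isCont_def by (rule tendsto_within_subset) simp
  then show "(v \<longlongrightarrow> p x) (at x within interior K)"
    by (rule Lim_transform_eventually) (auto simp: eventually_at_topological eq)
qed

lemma grad_eq:
  assumes "open S" "x \<in> S" and eq: "\<And>y. y \<in> S \<Longrightarrow> v y = p y" and D: "GDERIV p x :> D"
  shows "grad v x = D"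
  unfolding grad_def
proof (rule the_equality)
  show vD: "GDERIV v x :> D"
    using D unfolding gderiv_def
    by (rule has_derivative_transform_within_open[OF _ assms(1,2)]) (simp add: eq)
  fix D' assume "GDERIV v x :> D'"
  then have "(\<lambda>h. h \<bullet> D') = (\<lambda>h. h \<bullet> D)"
    using vD unfolding gderiv_def by (rule has_derivative_unique)
  then have "\<And>h. h \<bullet> D' = h \<bullet> D" by (rule fun_cong)
  then show "D' = D"
    by (metis vector_eq_ldot)
qed

section \<open>Convex cells in the plane\<close>

text \<open>p is b - a turned by a right angle. A point slightly off the midpoint, on the side of y,
  lies strictly between y and a point of the segment, hence in the interior by convexity.\<close>

lemma convex_interior_beside_segment:
  fixes A :: "(real^2) set"
  assumes A: "convex A" "closed_segment a b \<subseteq> A" "y \<in> interior A"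
    and p: "p = vector [- (b - a) $ 2, (b - a) $ 1]" and y: "p \<bullet> (y - a) \<noteq> 0"
  shows "\<exists>e0>0. \<forall>e. 0 < e \<and> e < e0 \<longrightarrow> midpoint a b + (sgn (p \<bullet> (y - a)) * e) *\<^sub>R p \<in> interior A"
proof -
  define w where "w = b - a"
  define m where "m = midpoint a b"
  have pw: "p = vector [- w $ 2, w $ 1]" by (simp add: p w_def)
  have "w \<noteq> 0" using y by (auto simp: pw inner_vec_def sum_2)
  then have ww: "w \<bullet> w > 0" by simp
  have pm: "p \<bullet> (y - m) = p \<bullet> (y - a)"
    by (simp add: pw w_def m_def midpoint_def inner_vec_def sum_2 field_simps)
  define s where "s = w \<bullet> (y - m) / (w \<bullet> w)"
  define t where "t = p \<bullet> (y - a) / (w \<bullet> w)"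
  have t: "t \<noteq> 0" "sgn t = sgn (p \<bullet> (y - a))" using y ww by (auto simp: t_def sgn_divide)
  \<comment> \<open>w and p are orthogonal and equally long, so one denominator serves both
    components.\<close>
  have "(w \<bullet> w) *\<^sub>R (y - m) = (w \<bullet> (y - m)) *\<^sub>R w + (p \<bullet> (y - m)) *\<^sub>R p"
    by (simp add: pw vec_eq_iff forall_2 inner_vec_def sum_2 algebra_simps)
  then have "y - m = (1 / (w \<bullet> w)) *\<^sub>R ((w \<bullet> (y - m)) *\<^sub>R w + (p \<bullet> (y - m)) *\<^sub>R p)"
    using ww by (metis divideR_right less_irrefl inverse_eq_divide)
  then have "y - m = s *\<^sub>R w + t *\<^sub>R p"
    by (simp add: s_def t_def scaleR_add_right flip: pm)
  then have decomp: "y = m + s *\<^sub>R w + t *\<^sub>R p"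
    by (simp add: algebra_simps)
  \<comment> \<open>For e < e0 the weight l = e / |t| satisfies l (|s| + 1) < 1/4, which will give
    |q| \<le> 1/2.\<close>
  define e0 where "e0 = \<bar>t\<bar> * (1 / (4 * (\<bar>s\<bar> + 1)))"
  have "e0 > 0" using t by (simp add: e0_def)
  moreover have "m + (sgn (p \<bullet> (y - a)) * e) *\<^sub>R p \<in> interior A" if e: "0 < e" "e < e0" for e
  proof -
    define l where "l = e / \<bar>t\<bar>"
    have l: "0 < l" "l < 1 / (4 * (\<bar>s\<bar> + 1))"
      using e t by (auto simp: l_def e0_def field_simps)
    have l4: "l * (\<bar>s\<bar> + 1) < 1 / 4"
      using l by (simp add: field_simps)
    have "l \<le> l * (\<bar>s\<bar> + 1)" using l by simp
    then have l1: "l < 1 / 4" using l4 by linarith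
    have ls: "\<bar>l * s\<bar> \<le> 1 / 4"
      using l l4 by (simp add: abs_mult distrib_left)
    \<comment> \<open>Requiring (1 - l) (m - q w) + l y to have no component along w forces this q.
      The bound 1/2 keeps m - q w on the segment.\<close>
    define q where "q = l * s / (1 - l)"
    have "\<bar>q\<bar> = \<bar>l * s\<bar> / (1 - l)" using l1 by (simp add: q_def)
    also have "\<dots> \<le> 1 / 2" using ls l1 by (simp add: field_simps)
    finally have q: "\<bar>q\<bar> \<le> 1 / 2" .
    have "m - q *\<^sub>R w = (1 - (1/2 - q)) *\<^sub>R a + (1/2 - q) *\<^sub>R b"
      by (simp add: m_def w_def midpoint_def vec_eq_iff algebra_simps)
    then have "m - q *\<^sub>R w \<in> closed_segment a b"
      using q unfolding in_segment by (intro exI[of _ "1/2 - q"]) (auto simp: abs_le_iff)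
    then have "(m - q *\<^sub>R w) - l *\<^sub>R ((m - q *\<^sub>R w) - y) \<in> interior A"
      using mem_interior_convex_shrink[OF A(1,3)] A(2) l l1 by auto
    also have "(m - q *\<^sub>R w) - l *\<^sub>R ((m - q *\<^sub>R w) - y)
        = m - ((1 - l) * q) *\<^sub>R w + (l * s) *\<^sub>R w + (l * t) *\<^sub>R p"
      by (subst decomp) (simp add: vec_eq_iff algebra_simps)
    also have "(1 - l) * q = l * s" using l1 by (simp add: q_def)
    also have "l * t = sgn (p \<bullet> (y - a)) * e"
      unfolding t(2)[symmetric] using t(1) by (simp add: l_def sgn_real_def)
    finally show ?thesis by simp
  qed
  ultimately show ?thesis by (auto simp: m_def)
qed

lemma interior_point_off_line:
  fixes A :: "'a::euclidean_space set"
  assumes "interior A \<noteq> {}" "p \<noteq> 0"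
  shows "\<exists>y\<in>interior A. p \<bullet> (y - a) \<noteq> 0"
proof (rule ccontr)
  assume "\<not> ?thesis"
  then have "interior A \<subseteq> {y. p \<bullet> y = p \<bullet> a}"
    by (auto simp: inner_diff_right)
  then have "interior A \<subseteq> interior {y. p \<bullet> y = p \<bullet> a}"
    by (simp add: interior_maximal)
  then show False
    using assms by (simp add: interior_hyperplane)
qed

text \<open>Both interiors contain all sufficiently short normal offsets of the midpoint towards the
  common side.\<close>

lemma convex_common_segment:
  fixes A B :: "(real^2) set"
  assumes "convex A" "closed_segment a b \<subseteq> A" "y \<in> interior A" "p \<bullet> (y - a) \<noteq> 0"
    and "convex B" "closed_segment a b \<subseteq> B" "z \<in> interior B" "p \<bullet> (z - a) \<noteq> 0"
    and p: "p = vector [- (b - a) $ 2, (b - a) $ 1]"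
    and sgn: "sgn (p \<bullet> (y - a)) = sgn (p \<bullet> (z - a))"
  shows "interior A \<inter> interior B \<noteq> {}"
proof -
  obtain e1 where e1: "e1 > 0"
    "\<And>e. 0 < e \<Longrightarrow> e < e1 \<Longrightarrow> midpoint a b + (sgn (p \<bullet> (y - a)) * e) *\<^sub>R p \<in> interior A"
    using convex_interior_beside_segment[OF assms(1-3) p assms(4)] by blast
  obtain e2 where e2: "e2 > 0"
    "\<And>e. 0 < e \<Longrightarrow> e < e2 \<Longrightarrow> midpoint a b + (sgn (p \<bullet> (z - a)) * e) *\<^sub>R p \<in> interior B"
    using convex_interior_beside_segment[OF assms(5-7) p assms(8)] by blast
  have "0 < min e1 e2 / 2" "min e1 e2 / 2 < e1" "min e1 e2 / 2 < e2"
    using e1(1) e2(1) by auto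
  then show ?thesis
    using e1(2) e2(2) sgn by (metis disjoint_iff)
qed

text \<open>Pigeonhole: a segment has two sides, and sets with disjoint interiors must occupy
  different ones. Consequently an interior edge of a mesh lies in no third cell.\<close>

lemma three_convex_sets_common_segment:
  fixes A B C :: "(real^2) set"
  assumes "a \<noteq> b"
    and A: "convex A" "closed_segment a b \<subseteq> A" "interior A \<noteq> {}"
    and B: "convex B" "closed_segment a b \<subseteq> B" "interior B \<noteq> {}"
    and C: "convex C" "closed_segment a b \<subseteq> C" "interior C \<noteq> {}"
    and AB: "interior A \<inter> interior B = {}"
    and AC: "interior A \<inter> interior C = {}"
  shows "interior B \<inter> interior C \<noteq> {}"
proof -
  define p :: "real^2" where "p = vector [- (b - a) $ 2, (b - a) $ 1]"
  have "p \<noteq> 0"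
    using \<open>a \<noteq> b\<close> by (auto simp: p_def vec_eq_iff forall_2)
  note off = interior_point_off_line[OF _ this, of _ a]
  obtain x where x: "x \<in> interior A" "p \<bullet> (x - a) \<noteq> 0" using off[OF A(3)] by blast
  obtain y where y: "y \<in> interior B" "p \<bullet> (y - a) \<noteq> 0" using off[OF B(3)] by blast
  obtain z where z: "z \<in> interior C" "p \<bullet> (z - a) \<noteq> 0" using off[OF C(3)] by blast
  have "sgn (p \<bullet> (x - a)) \<noteq> sgn (p \<bullet> (y - a))"
    using convex_common_segment[OF A(1,2) x B(1,2) y p_def] AB by blast
  moreover have "sgn (p \<bullet> (x - a)) \<noteq> sgn (p \<bullet> (z - a))"
    using convex_common_segment[OF A(1,2) x C(1,2) z p_def] AC by blast
  ultimately have "sgn (p \<bullet> (y - a)) = sgn (p \<bullet> (z - a))"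
    using x y z by (auto simp: sgn_real_def split: if_splits)
  then show ?thesis
    using convex_common_segment[OF B(1,2) y C(1,2) z p_def] by blast
qed

text \<open>Non-collinear vertices force affine dimension 2, and for a full-dimensional convex set
  the interior is the relative interior, which is non-empty.\<close>

lemma cell_properties:
  assumes "triangle K \<or> rectangle K"
  shows "convex K" "compact K" "interior K \<noteq> {}"
proof -
  obtain S where S: "finite S" "K = convex hull S" "\<not> collinear S"
  proof (cases "triangle K")
    case True
    then obtain a b c where "\<not> collinear {a, b, c}" "K = convex hull {a, b, c}"
      unfolding Defs.triangle_def by blast
    then show ?thesis by (intro that[of "{a, b, c}"]) auto
  next
    case False
    then obtain a u v where uv: "u \<noteq> 0" "v \<noteq> 0" "u \<bullet> v = 0"
      and K: "K = convex hull {a, a + u, a + v, a + u + v}"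
      using assms unfolding rectangle_def by blast
    \<comment> \<open>On a line u and v would be multiples of one vector, and orthogonality would
      make one of them zero.\<close>
    have "\<not> collinear {a, a + u, a + v, a + u + v}"
    proof
      assume "collinear {a, a + u, a + v, a + u + v}"
      then obtain w where w: "\<And>x y. x \<in> {a, a + u, a + v, a + u + v} \<Longrightarrow> y \<in> {a, a + u, a + v, a + u + v}
          \<Longrightarrow> \<exists>c. x - y = c *\<^sub>R w"
        unfolding collinear_def by blast
      obtain c where c: "u = c *\<^sub>R w" using w[of "a + u" a] by auto
      obtain d where d: "v = d *\<^sub>R w" using w[of "a + v" a] by auto
      show False using uv c d by auto
    qed
    then show ?thesis using K by (intro that[of "{a, a + u, a + v, a + u + v}"]) auto
  qed
  show "convex K" "compact K"
    using S by (simp_all add: finite_imp_compact_convex_hull)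
  have "\<not> aff_dim S \<le> 1"
    using S by (simp add: collinear_aff_dim)
  moreover have "aff_dim S \<le> 2"
    using aff_dim_le_DIM[of S] by simp
  ultimately have "aff_dim K = 2"
    by (simp add: S(2) aff_dim_convex_hull)
  then have "interior K = rel_interior K"
    by (subst interior_rel_interior_gen) simp
  moreover have "K \<noteq> {}" using \<open>aff_dim K = 2\<close> by auto
  ultimately show "interior K \<noteq> {}"
    using \<open>convex K\<close> by (simp add: rel_interior_eq_empty)
qed

section \<open>Powers and cell polynomials\<close>

lemma dpow_eq_power:
  assumes "\<delta> \<in> \<int>" "\<delta> \<ge> 1"
  shows "\<exists>n>0. \<delta> = real n \<and> (\<forall>s. dpow \<delta> s = s ^ n)"
proof -
  obtain k where k: "\<delta> = of_int k" using assms(1) by (auto elim: Ints_cases)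
  then have "k \<ge> 1" using assms(2) by simp
  then have "\<delta> = real (nat k)" "nat k > 0" "\<forall>s. dpow \<delta> s = s ^ nat k"
    using k assms(1) by (auto simp: dpow_def power_int_def)
  then show ?thesis by blast
qed

lemma continuous_dpow:
  assumes "\<delta> \<ge> 1"
  shows "continuous_on UNIV (dpow \<delta>)"
proof (cases "\<delta> \<in> \<int>")
  case True
  then obtain n where "\<forall>s. dpow \<delta> s = s ^ n" using dpow_eq_power assms by blast
  then have "dpow \<delta> = (\<lambda>s. s ^ n)" by auto
  then show ?thesis by (simp add: continuous_intros)
next
  case False
  then have "dpow \<delta> = (\<lambda>s. \<bar>s\<bar> powr \<delta>)" by (auto simp: dpow_def)
  moreover have "continuous_on UNIV (\<lambda>s::real. \<bar>s\<bar> powr \<delta>)"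
    by (rule continuous_on_powr') (use assms in \<open>auto intro!: continuous_intros\<close>)
  ultimately show ?thesis by simp
qed

lemma dpow_scale:
  assumes "\<delta> \<ge> 1" "r > 0"
  shows "dpow \<delta> (r * s) = r powr \<delta> * dpow \<delta> s"
proof (cases "\<delta> \<in> \<int>")
  case True
  then obtain n where "n > 0" "\<delta> = real n" "\<forall>s. dpow \<delta> s = s ^ n" using dpow_eq_power assms by blast
  then show ?thesis using assms by (simp add: power_mult_distrib powr_realpow)
next
  case False
  then show ?thesis using assms by (simp add: dpow_def abs_mult powr_mult)
qed

lemma dpow_nonzero:
  assumes "\<delta> \<ge> 1" "s \<noteq> 0"
  shows "dpow \<delta> s \<noteq> 0"
proof (cases "\<delta> \<in> \<int>")
  case True
  then obtain n where "n > 0" "\<forall>s. dpow \<delta> s = s ^ n" using dpow_eq_power assms by blast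
  then show ?thesis using assms by simp
next
  case False
  then show ?thesis using assms by (simp add: dpow_def)
qed

section \<open>Homogeneous forms given by integrals\<close>

lemma linear_coords_integral:
  fixes G :: "(nat \<Rightarrow> real) \<Rightarrow> 'a::euclidean_space \<Rightarrow> real"
  assumes "\<And>x. linear_coords (\<lambda>d. G d x)" and "\<And>d. set_integrable lebesgue S (G d)"
  shows "linear_coords (\<lambda>d. LINT x:S|lebesgue. G d x)"
  unfolding linear_coords_def
proof (intro allI)
  fix s d d'
  have "(LINT x:S|lebesgue. G (\<lambda>i. s * d i + d' i) x) = (LINT x:S|lebesgue. s * G d x + G d' x)"
    using linear_coordsD[OF assms(1)] by simp
  also have "\<dots> = s * (LINT x:S|lebesgue. G d x) + (LINT x:S|lebesgue. G d' x)"
    using assms(2) by (simp add: set_integral_add)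
  finally show "(LINT x:S|lebesgue. G (\<lambda>i. s * d i + d' i) x)
      = s * (LINT x:S|lebesgue. G d x) + (LINT x:S|lebesgue. G d' x)" .
qed

lemma homogeneous_form_integral:
  fixes G :: "(nat \<Rightarrow> real) \<Rightarrow> (nat \<Rightarrow> real) \<Rightarrow> 'a::euclidean_space \<Rightarrow> real"
  assumes cont: "\<And>d. continuous_on UNIV (\<lambda>z. G (fst z) d (snd z))"
    and lin: "\<And>c x. linear_coords (\<lambda>d. G c d x)"
    and hom: "\<And>r c d x. r > 0 \<Longrightarrow> G (\<lambda>i. r * c i) d x = r powr p * G c d x"
    and S: "S \<in> sets lebesgue" "bounded S"
  shows "homogeneous_form p (\<lambda>c d. LINT x:S|lebesgue. G c d x)"
proof -
  have "continuous_on UNIV (G c d)" for c d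
    using continuous_on_compose2[OF cont, of UNIV "\<lambda>x. (c, x)" d] by (simp add: continuous_intros)
  then have int: "set_integrable lebesgue S (G c d)" for c d
    by (rule set_integrable_continuous_bounded[OF _ S])
  show ?thesis
    unfolding homogeneous_form_def
  proof (intro conjI allI impI)
    show "linear_coords (\<lambda>d. LINT x:S|lebesgue. G c d x)" for c
      by (rule linear_coords_integral[OF lin int])
    show "continuous_on UNIV (\<lambda>c. LINT x:S|lebesgue. G c d x)" for d
      by (rule continuous_on_parametric_integral[OF cont S])
    show "(LINT x:S|lebesgue. G (\<lambda>i. r * c i) d x) = r powr p * (LINT x:S|lebesgue. G c d x)"
      if "r > 0" for r c d
      using hom[OF that] by simp
  qed
qed

lemma homogeneous_form_add:
  "homogeneous_form p Q \<Longrightarrow> homogeneous_form p Q' \<Longrightarrow> homogeneous_form p (\<lambda>c d. Q c d + Q' c d)"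
  unfolding homogeneous_form_def linear_coords_def
  by (auto intro!: continuous_intros simp: algebra_simps)

lemma homogeneous_form_scale:
  "homogeneous_form p Q \<Longrightarrow> homogeneous_form p (\<lambda>c d. s * Q c d)"
  unfolding homogeneous_form_def linear_coords_def
  by (auto intro!: continuous_intros simp: algebra_simps)

lemma homogeneous_form_sum:
  assumes "\<And>i. i \<in> I \<Longrightarrow> homogeneous_form p (Q i)"
  shows "homogeneous_form p (\<lambda>c d. \<Sum>i\<in>I. Q i c d)"
proof -
  have "homogeneous_form p (\<lambda>c d. 0)"
    by (simp add: homogeneous_form_def linear_coords_def)
  then show ?thesis
    using assms by (induction I rule: infinite_finite_induct) (auto intro: homogeneous_form_add)
qed

text \<open>One sequence carries the polynomials of all cells: the cell with number j owns the block
  of four entries from 4 j to 4 j + 3.\<close>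

definition cell_poly :: "(nat \<Rightarrow> real) \<Rightarrow> nat \<Rightarrow> real^2 \<Rightarrow> real" where
  "cell_poly c j x = c (4 * j) + c (4 * j + 1) * x $ 1 + c (4 * j + 2) * x $ 2
     + c (4 * j + 3) * x $ 1 * x $ 2"

definition cell_grad :: "(nat \<Rightarrow> real) \<Rightarrow> nat \<Rightarrow> real^2 \<Rightarrow> real^2" where
  "cell_grad c j x = vector [c (4 * j + 1) + c (4 * j + 3) * x $ 2, c (4 * j + 2) + c (4 * j + 3) * x $ 1]"

lemma linear_cell_poly: "linear_coords (\<lambda>c. cell_poly c j x)"
  by (simp add: linear_coords_def cell_poly_def algebra_simps)

lemma linear_cell_grad: "linear_coords (\<lambda>c. cell_grad c j x \<bullet> n)"
  by (simp add: linear_coords_def cell_grad_def inner_vec_def sum_2 algebra_simps)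

lemma continuous_cell_poly: "continuous_on UNIV (\<lambda>z. cell_poly (fst z) j (snd z))"
  unfolding cell_poly_def by (intro continuous_intros)

lemma continuous_cell_poly_space: "continuous_on UNIV (cell_poly c j)"
  unfolding cell_poly_def by (intro continuous_intros)

lemma continuous_cell_grad: "continuous_on UNIV (\<lambda>z. cell_grad (fst z) j (snd z) \<bullet> n)"
  unfolding cell_grad_def inner_vec_def sum_2 by (simp, intro continuous_intros)

lemma continuous_on_vector_2:
  fixes f g :: "'a::topological_space \<Rightarrow> real"
  assumes "continuous_on S f" "continuous_on S g"
  shows "continuous_on S (\<lambda>x. vector [f x, g x] :: real^2)"
proof -
  have "vector [f x, g x] = (\<chi> i::2. if i = 1 then f x else g x)" for x
    by (simp add: vec_eq_iff forall_2)
  moreover have "continuous_on S (\<lambda>x. if i = 1 then f x else g x)" for i :: 2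
    using assms by (cases "i = 1") auto
  ultimately show ?thesis
    by (simp add: continuous_on_vec_lambda)
qed

lemma continuous_cell_grad_space: "continuous_on UNIV (cell_grad c j)"
  unfolding cell_grad_def by (intro continuous_on_vector_2 continuous_intros)

lemma GDERIV_cell_poly: "GDERIV (cell_poly c j) x :> cell_grad c j x"
  unfolding gderiv_def cell_poly_def cell_grad_def inner_vec_def sum_2
  by (auto intro!: derivative_eq_intros bounded_linear_imp_has_derivative[OF bounded_linear_vec_nth]
      simp: algebra_simps)

text \<open>A polynomial of partial degree at most 1 is determined by its values at the corners of a
  small square inside \<open>S\<close>.\<close>

lemma cell_poly_nonzero:
  assumes "open S" "S \<noteq> {}" and "i div 4 = j" "c i \<noteq> 0"
  shows "\<exists>x\<in>S. cell_poly c j x \<noteq> 0"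
proof (rule ccontr)
  assume "\<not> ?thesis"
  then have zero: "\<And>x. x \<in> S \<Longrightarrow> cell_poly c j x = 0" by blast
  obtain z e where z: "z \<in> S" "e > 0" and ball: "ball z e \<subseteq> S"
    using assms(1,2) open_contains_ball by blast
  \<comment> \<open>A corner is displaced by at most 2 t = e / 2, so all four corners stay in the
    ball.\<close>
  define t where "t = e / 4"
  have t: "t > 0" using z by (simp add: t_def)
  have "z + vector [s * t, r * t] \<in> S" if "s \<in> {0, 1}" "r \<in> {0, 1}" for s r
  proof -
    have "norm (vector [s * t, r * t] :: real^2) \<le> \<bar>s * t\<bar> + \<bar>r * t\<bar>"
      using norm_le_l1_cart[of "vector [s * t, r * t] :: real^2"] by (simp add: sum_2)
    also have "\<dots> \<le> t + t" using that t by (intro add_mono) auto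
    also have "\<dots> < e" using z by (simp add: t_def)
    finally show ?thesis using ball by (auto simp: dist_norm subset_iff)
  qed
  from zero[OF this[of 0 0]] zero[OF this[of 1 0]] zero[OF this[of 0 1]] zero[OF this[of 1 1]]
  have eqs: "c (4 * j) + c (4 * j + 1) * z $ 1 + c (4 * j + 2) * z $ 2 + c (4 * j + 3) * z $ 1 * z $ 2 = 0"
    "c (4 * j) + c (4 * j + 1) * (z $ 1 + t) + c (4 * j + 2) * z $ 2 + c (4 * j + 3) * (z $ 1 + t) * z $ 2 = 0"
    "c (4 * j) + c (4 * j + 1) * z $ 1 + c (4 * j + 2) * (z $ 2 + t) + c (4 * j + 3) * z $ 1 * (z $ 2 + t) = 0"
    "c (4 * j) + c (4 * j + 1) * (z $ 1 + t) + c (4 * j + 2) * (z $ 2 + t) + c (4 * j + 3) * (z $ 1 + t) * (z $ 2 + t) = 0"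
    by (simp_all add: cell_poly_def)
  have "q = 0 \<and> p = 0 \<and> b = 0 \<and> a = 0"
    if "a + b * x + p * y + q * x * y = 0" "a + b * (x + t) + p * y + q * (x + t) * y = 0"
      "a + b * x + p * (y + t) + q * x * (y + t) = 0"
      "a + b * (x + t) + p * (y + t) + q * (x + t) * (y + t) = 0" for a b p q x y :: real
  proof -
    \<comment> \<open>The mixed second difference isolates the coefficient of the product term;
      after that, first differences in each variable isolate the linear ones.\<close>
    have "q * (t * t) = (a + b * (x + t) + p * (y + t) + q * (x + t) * (y + t))
        - (a + b * (x + t) + p * y + q * (x + t) * y)
        - (a + b * x + p * (y + t) + q * x * (y + t)) + (a + b * x + p * y + q * x * y)"
      by (simp add: algebra_simps)
    then have "q * (t * t) = 0" unfolding that by simp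
    then have q: "q = 0" using t by simp
    have "p * t = (a + b * x + p * (y + t) + q * x * (y + t)) - (a + b * x + p * y + q * x * y)"
      by (simp add: q algebra_simps)
    then have "p * t = 0" unfolding that by simp
    then have p: "p = 0" using t by simp
    have "b * t = (a + b * (x + t) + p * y + q * (x + t) * y) - (a + b * x + p * y + q * x * y)"
      by (simp add: q p algebra_simps)
    then have "b * t = 0" unfolding that by simp
    then have "b = 0" using t by simp
    then show ?thesis using that(1) q p by simp
  qed
  from this[OF eqs]
  have *: "c (4 * j + 3) = 0 \<and> c (4 * j + 2) = 0 \<and> c (4 * j + 1) = 0 \<and> c (4 * j) = 0" .
  have "i = 4 * j \<or> i = 4 * j + 1 \<or> i = 4 * j + 2 \<or> i = 4 * j + 3"
    using assms(3) by presburger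
  then show False
    using * assms(4) by auto
qed

section \<open>Functionals of the coefficients\<close>

text \<open>h is an arbitrary numbering of the cells; it assigns to each cell its block of
  coefficients.\<close>

locale dg_mesh =
  fixes \<Omega> :: "(real^2) set" and T :: "(real^2) set set" and h :: "(real^2) set \<Rightarrow> nat"
  assumes open_domain: "open \<Omega>" and nonempty_domain: "\<Omega> \<noteq> {}" and bounded_domain: "bounded \<Omega>"
    and mesh: "mesh \<Omega> T" and bij_index: "bij_betw h T {..<card T}"
begin

lemma finite_cells: "finite T"
  using mesh by (simp add: mesh_def)

lemma cell:
  assumes "K \<in> T"
  shows "convex K" "compact K" "closed K" "interior K \<noteq> {}" "bounded K"
  using cell_properties[of K] assms mesh by (auto simp: mesh_def compact_imp_closed compact_imp_bounded)

lemma cells_cover: "\<Union>T = closure \<Omega>"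
  using mesh by (simp add: mesh_def)

lemma interiors_disjoint: "K \<in> T \<Longrightarrow> K' \<in> T \<Longrightarrow> K \<noteq> K' \<Longrightarrow> interior K \<inter> interior K' = {}"
  using mesh by (auto simp: mesh_def pairwise_def)

lemma domain_subset_cells: "\<Omega> \<subseteq> \<Union>T"
  using cells_cover closure_subset by blast

text \<open>An open set meeting the closure of the domain meets the domain itself. Thus the
  coefficients of every cell are visible to integrals over the domain.\<close>

lemma cell_meets_domain: "K \<in> T \<Longrightarrow> interior K \<inter> \<Omega> \<noteq> {}"
proof -
  assume K: "K \<in> T"
  then have "interior K \<inter> closure \<Omega> \<noteq> {}"
    using cell(4)[OF K] cells_cover interior_subset[of K] by blast
  then show ?thesis
    by (simp add: open_Int_closure_eq_empty)
qed

text \<open>Only cell interiors are compared, as in \<open>V_DG\<close>: c fixes v on the domain up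
  to a null set, while entries of c outside the blocks of the mesh stay free.\<close>

definition represents :: "(nat \<Rightarrow> real) \<Rightarrow> (real^2 \<Rightarrow> real) \<Rightarrow> bool" where
  "represents c v \<longleftrightarrow> (\<forall>K\<in>T. \<forall>x\<in>interior K. v x = cell_poly c (h K) x)"

text \<open>\<open>g v\<close> is to be computed on \<open>I\<close> from the coefficients of \<open>v\<close> alone. The witnesses \<open>G\<close> are
  continuous on the whole plane, so the values of \<open>g v\<close> on the skeleton do not matter
  and integrals over \<open>I\<close> inherit continuity in the coefficients.\<close>

definition homogeneous_field :: "real \<Rightarrow> (real^2) set \<Rightarrow> ((real^2 \<Rightarrow> real) \<Rightarrow> real^2 \<Rightarrow> real) \<Rightarrow> bool" where
  "homogeneous_field p I g \<longleftrightarrow> (\<exists>G.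
     (\<forall>c v. represents c v \<longrightarrow> (\<forall>x\<in>I. g v x = G c x)) \<and>
     continuous_on UNIV (\<lambda>z. G (fst z) (snd z)) \<and>
     (\<forall>r>0. \<forall>c x. G (\<lambda>i. r * c i) x = r powr p * G c x))"

definition linear_field :: "(real^2) set \<Rightarrow> ((real^2 \<Rightarrow> real) \<Rightarrow> real^2 \<Rightarrow> real) \<Rightarrow> bool" where
  "linear_field I g \<longleftrightarrow> (\<exists>G.
     (\<forall>c v. represents c v \<longrightarrow> (\<forall>x\<in>I. g v x = G c x)) \<and>
     continuous_on UNIV (\<lambda>z. G (fst z) (snd z)) \<and>
     (\<forall>x. linear_coords (\<lambda>c. G c x)))"

text \<open>The integrand version of \<open>homogeneous_form\<close>: v is the unknown and \<eta>
  the test function. Integration over a bounded set turns the one into the other.\<close>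

definition pairing_field ::
  "real \<Rightarrow> (real^2) set \<Rightarrow> ((real^2 \<Rightarrow> real) \<Rightarrow> (real^2 \<Rightarrow> real) \<Rightarrow> real^2 \<Rightarrow> real) \<Rightarrow> bool" where
  "pairing_field p I g \<longleftrightarrow> (\<exists>G.
     (\<forall>c d v \<eta>. represents c v \<longrightarrow> represents d \<eta> \<longrightarrow> (\<forall>x\<in>I. g v \<eta> x = G c d x)) \<and>
     (\<forall>d. continuous_on UNIV (\<lambda>z. G (fst z) d (snd z))) \<and>
     (\<forall>r>0. \<forall>c d x. G (\<lambda>i. r * c i) d x = r powr p * G c d x) \<and>
     (\<forall>c x. linear_coords (\<lambda>d. G c d x)))"

text \<open>Independence of the values on the skeleton is built in: all pairs of functions
  represented by the same c and d must yield the same number.\<close>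

definition homogeneous_functional :: "real \<Rightarrow> ((real^2 \<Rightarrow> real) \<Rightarrow> (real^2 \<Rightarrow> real) \<Rightarrow> real) \<Rightarrow> bool" where
  "homogeneous_functional p B \<longleftrightarrow> (\<exists>Q. homogeneous_form p Q \<and>
     (\<forall>c d v \<eta>. represents c v \<longrightarrow> represents d \<eta> \<longrightarrow> B v \<eta> = Q c d))"

section \<open>Calculus of fields and functionals\<close>

lemma linear_fieldI:
  assumes "\<And>c v x. represents c v \<Longrightarrow> x \<in> I \<Longrightarrow> g v x = G c x"
    and "continuous_on UNIV (\<lambda>z. G (fst z) (snd z))" and "\<And>x. linear_coords (\<lambda>c. G c x)"
  shows "linear_field I g"
  unfolding linear_field_def using assms by (intro exI[of _ G]) simp

lemma homogeneous_fieldI: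
  assumes "\<And>c v x. represents c v \<Longrightarrow> x \<in> I \<Longrightarrow> g v x = G c x"
    and "continuous_on UNIV (\<lambda>z. G (fst z) (snd z))"
    and "\<And>r c x. r > 0 \<Longrightarrow> G (\<lambda>i. r * c i) x = r powr p * G c x"
  shows "homogeneous_field p I g"
  unfolding homogeneous_field_def using assms by (intro exI[of _ G]) simp

lemma pairing_fieldI:
  assumes "\<And>c d v \<eta> x. represents c v \<Longrightarrow> represents d \<eta> \<Longrightarrow> x \<in> I \<Longrightarrow> g v \<eta> x = G c d x"
    and "\<And>d. continuous_on UNIV (\<lambda>z. G (fst z) d (snd z))"
    and "\<And>r c d x. r > 0 \<Longrightarrow> G (\<lambda>i. r * c i) d x = r powr p * G c d x"
    and "\<And>c x. linear_coords (\<lambda>d. G c d x)"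
  shows "pairing_field p I g"
  unfolding pairing_field_def using assms by (intro exI[of _ G]) simp

lemma pairing_fieldE:
  assumes "pairing_field p I g"
  obtains G where "\<And>c d v \<eta> x. represents c v \<Longrightarrow> represents d \<eta> \<Longrightarrow> x \<in> I \<Longrightarrow> g v \<eta> x = G c d x"
    and "\<And>d. continuous_on UNIV (\<lambda>z. G (fst z) d (snd z))"
    and "\<And>r c d x. r > 0 \<Longrightarrow> G (\<lambda>i. r * c i) d x = r powr p * G c d x"
    and "\<And>c x. linear_coords (\<lambda>d. G c d x)"
proof -
  obtain G where "(\<forall>c d v \<eta>. represents c v \<longrightarrow> represents d \<eta> \<longrightarrow> (\<forall>x\<in>I. g v \<eta> x = G c d x)) \<and>
     (\<forall>d. continuous_on UNIV (\<lambda>z. G (fst z) d (snd z))) \<and>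
     (\<forall>r>0. \<forall>c d x. G (\<lambda>i. r * c i) d x = r powr p * G c d x) \<and>
     (\<forall>c x. linear_coords (\<lambda>d. G c d x))"
    using assms unfolding pairing_field_def by (rule exE)
  then show thesis by (intro that[of G]) simp_all
qed

lemma homogeneous_field_linear: "linear_field I g \<Longrightarrow> homogeneous_field 1 I g"
proof -
  assume "linear_field I g"
  then obtain G where G: "\<And>c v x. represents c v \<Longrightarrow> x \<in> I \<Longrightarrow> g v x = G c x"
    "continuous_on UNIV (\<lambda>z. G (fst z) (snd z))" "\<And>x. linear_coords (\<lambda>c. G c x)"
    unfolding linear_field_def by blast
  show ?thesis
    using G(1,2) linear_coords_scale[OF G(3)] by (intro homogeneous_fieldI[where G = G]) simp_all
qed

lemma linear_field_add:
  assumes "linear_field I f" "linear_field I g"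
  shows "linear_field I (\<lambda>v x. f v x + g v x)"
proof -
  obtain F where F: "\<And>c v x. represents c v \<Longrightarrow> x \<in> I \<Longrightarrow> f v x = F c x"
    "continuous_on UNIV (\<lambda>z. F (fst z) (snd z))" "\<And>x. linear_coords (\<lambda>c. F c x)"
    using assms(1) unfolding linear_field_def by blast
  obtain G where G: "\<And>c v x. represents c v \<Longrightarrow> x \<in> I \<Longrightarrow> g v x = G c x"
    "continuous_on UNIV (\<lambda>z. G (fst z) (snd z))" "\<And>x. linear_coords (\<lambda>c. G c x)"
    using assms(2) unfolding linear_field_def by blast
  show ?thesis
    by (rule linear_fieldI[of _ _ "\<lambda>c x. F c x + G c x"])
       (use F G in \<open>auto intro!: continuous_on_add simp: linear_coords_def algebra_simps\<close>)
qed

lemma linear_field_scale: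
  assumes "linear_field I f"
  shows "linear_field I (\<lambda>v x. s * f v x)"
proof -
  obtain F where F: "\<And>c v x. represents c v \<Longrightarrow> x \<in> I \<Longrightarrow> f v x = F c x"
    "continuous_on UNIV (\<lambda>z. F (fst z) (snd z))" "\<And>x. linear_coords (\<lambda>c. F c x)"
    using assms unfolding linear_field_def by blast
  show ?thesis
    by (rule linear_fieldI[of _ _ "\<lambda>c x. s * F c x"])
       (use F in \<open>auto intro!: continuous_on_mult_left simp: linear_coords_def algebra_simps\<close>)
qed

lemma linear_field_diff:
  assumes "linear_field I f" "linear_field I g"
  shows "linear_field I (\<lambda>v x. f v x - g v x)"
  using linear_field_add[OF assms(1) linear_field_scale[OF assms(2), of "-1"]] by simp

lemma linear_field_0: "linear_field I (\<lambda>v x. 0)"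
  by (rule linear_fieldI[of _ _ "\<lambda>c x. 0"]) (auto simp: linear_coords_def)

lemma homogeneous_field_mult:
  assumes "homogeneous_field p I f" "homogeneous_field q I g"
  shows "homogeneous_field (p + q) I (\<lambda>v x. f v x * g v x)"
proof -
  obtain F where F: "\<And>c v x. represents c v \<Longrightarrow> x \<in> I \<Longrightarrow> f v x = F c x"
    "continuous_on UNIV (\<lambda>z. F (fst z) (snd z))"
    "\<And>r c x. r > 0 \<Longrightarrow> F (\<lambda>i. r * c i) x = r powr p * F c x"
    using assms(1) unfolding homogeneous_field_def by blast
  obtain G where G: "\<And>c v x. represents c v \<Longrightarrow> x \<in> I \<Longrightarrow> g v x = G c x"
    "continuous_on UNIV (\<lambda>z. G (fst z) (snd z))"
    "\<And>r c x. r > 0 \<Longrightarrow> G (\<lambda>i. r * c i) x = r powr q * G c x"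
    using assms(2) unfolding homogeneous_field_def by blast
  show ?thesis
    by (rule homogeneous_fieldI[of _ _ "\<lambda>c x. F c x * G c x"])
       (use F G in \<open>auto intro!: continuous_on_mult simp: powr_add algebra_simps\<close>)
qed

lemma homogeneous_field_add:
  assumes "homogeneous_field p I f" "homogeneous_field p I g"
  shows "homogeneous_field p I (\<lambda>v x. f v x + g v x)"
proof -
  obtain F where F: "\<And>c v x. represents c v \<Longrightarrow> x \<in> I \<Longrightarrow> f v x = F c x"
    "continuous_on UNIV (\<lambda>z. F (fst z) (snd z))"
    "\<And>r c x. r > 0 \<Longrightarrow> F (\<lambda>i. r * c i) x = r powr p * F c x"
    using assms(1) unfolding homogeneous_field_def by blast
  obtain G where G: "\<And>c v x. represents c v \<Longrightarrow> x \<in> I \<Longrightarrow> g v x = G c x"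
    "continuous_on UNIV (\<lambda>z. G (fst z) (snd z))"
    "\<And>r c x. r > 0 \<Longrightarrow> G (\<lambda>i. r * c i) x = r powr p * G c x"
    using assms(2) unfolding homogeneous_field_def by blast
  show ?thesis
    by (rule homogeneous_fieldI[of _ _ "\<lambda>c x. F c x + G c x"])
       (use F G in \<open>auto intro!: continuous_on_add simp: algebra_simps\<close>)
qed

text \<open>This is how scalar non-linearities enter: \<open>\<phi>\<close> must be continuous and
  compatible with positive scaling, as \<open>abs\<close> and \<open>dpow\<close> are.\<close>

lemma homogeneous_field_compose:
  assumes "homogeneous_field p I f" and \<phi>: "continuous_on UNIV \<phi>"
    and hom: "\<And>r s. r > 0 \<Longrightarrow> \<phi> (r powr p * s) = r powr q * \<phi> s"
  shows "homogeneous_field q I (\<lambda>v x. \<phi> (f v x))"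
proof -
  obtain F where F: "\<And>c v x. represents c v \<Longrightarrow> x \<in> I \<Longrightarrow> f v x = F c x"
    "continuous_on UNIV (\<lambda>z. F (fst z) (snd z))"
    "\<And>r c x. r > 0 \<Longrightarrow> F (\<lambda>i. r * c i) x = r powr p * F c x"
    using assms(1) unfolding homogeneous_field_def by blast
  show ?thesis
    by (rule homogeneous_fieldI[of _ _ "\<lambda>c x. \<phi> (F c x)"])
       (use F hom in \<open>auto intro!: continuous_on_compose2[OF \<phi>]\<close>)
qed

lemma homogeneous_field_scale:
  "homogeneous_field p I f \<Longrightarrow> homogeneous_field p I (\<lambda>v x. s * f v x)"
  by (rule homogeneous_field_compose[where \<phi> = "\<lambda>y. s * y"]) (auto intro!: continuous_intros)

lemma homogeneous_field_abs:
  "homogeneous_field p I f \<Longrightarrow> homogeneous_field p I (\<lambda>v x. \<bar>f v x\<bar>)"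
  by (rule homogeneous_field_compose[where \<phi> = abs]) (auto intro!: continuous_intros simp: abs_mult)

lemma homogeneous_field_dpow:
  assumes "\<delta> \<ge> 1" "homogeneous_field 1 I f"
  shows "homogeneous_field \<delta> I (\<lambda>v x. dpow \<delta> (f v x))"
  by (rule homogeneous_field_compose[OF assms(2) continuous_dpow[OF assms(1)]])
     (use assms in \<open>simp add: dpow_scale\<close>)

lemma homogeneous_field_diff:
  assumes "homogeneous_field p I f" "homogeneous_field p I g"
  shows "homogeneous_field p I (\<lambda>v x. f v x - g v x)"
  using homogeneous_field_add[OF assms(1) homogeneous_field_scale[OF assms(2), of "-1"]] by simp

lemma homogeneous_field_cong:
  "homogeneous_field p I f \<Longrightarrow> (\<And>c v x. represents c v \<Longrightarrow> x \<in> I \<Longrightarrow> g v x = f v x) \<Longrightarrow> homogeneous_field p I g"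
proof -
  assume f: "homogeneous_field p I f" and eq: "\<And>c v x. represents c v \<Longrightarrow> x \<in> I \<Longrightarrow> g v x = f v x"
  obtain F where F: "\<And>c v x. represents c v \<Longrightarrow> x \<in> I \<Longrightarrow> f v x = F c x"
    "continuous_on UNIV (\<lambda>z. F (fst z) (snd z))"
    "\<And>r c x. r > 0 \<Longrightarrow> F (\<lambda>i. r * c i) x = r powr p * F c x"
    using f unfolding homogeneous_field_def by blast
  show ?thesis
    using F eq by (intro homogeneous_fieldI[where G = F]) simp_all
qed

lemma pairing_field_mult:
  assumes "homogeneous_field p I f" "linear_field I g"
  shows "pairing_field p I (\<lambda>v \<eta> x. f v x * g \<eta> x)"
proof -
  obtain F where F: "\<And>c v x. represents c v \<Longrightarrow> x \<in> I \<Longrightarrow> f v x = F c x"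
    "continuous_on UNIV (\<lambda>z. F (fst z) (snd z))"
    "\<And>r c x. r > 0 \<Longrightarrow> F (\<lambda>i. r * c i) x = r powr p * F c x"
    using assms(1) unfolding homogeneous_field_def by blast
  obtain G where G: "\<And>c v x. represents c v \<Longrightarrow> x \<in> I \<Longrightarrow> g v x = G c x"
    "continuous_on UNIV (\<lambda>z. G (fst z) (snd z))" "\<And>x. linear_coords (\<lambda>c. G c x)"
    using assms(2) unfolding linear_field_def by blast
  have "continuous_on UNIV (\<lambda>z::(nat \<Rightarrow> real) \<times> (real^2). (d, snd z))" for d :: "nat \<Rightarrow> real"
    by (intro continuous_intros)
  from continuous_on_compose2[OF G(2) this]
  have "continuous_on UNIV (\<lambda>z::(nat \<Rightarrow> real) \<times> (real^2). G d (snd z))" for d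
    by simp
  then show ?thesis
    by (intro pairing_fieldI[where G = "\<lambda>c d x. F c x * G d x"])
       (use F G in \<open>auto intro!: continuous_on_mult simp: linear_coords_def algebra_simps\<close>)
qed

text \<open>For the symmetric terms of \<open>a_DG\<close>, in which the test function is the first
  factor.\<close>

lemma pairing_field_mult_swap:
  assumes "linear_field I g" "homogeneous_field p I f"
  shows "pairing_field p I (\<lambda>v \<eta> x. g \<eta> x * f v x)"
  using pairing_field_mult[OF assms(2,1)] by (simp add: mult.commute)

lemma pairing_field_add:
  assumes "pairing_field p I f" "pairing_field p I g"
  shows "pairing_field p I (\<lambda>v \<eta> x. f v \<eta> x + g v \<eta> x)"
proof -
  obtain F where F:
    "\<And>c d v \<eta> x. represents c v \<Longrightarrow> represents d \<eta> \<Longrightarrow> x \<in> I \<Longrightarrow> f v \<eta> x = F c d x"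
    "\<And>d. continuous_on UNIV (\<lambda>z. F (fst z) d (snd z))"
    "\<And>r c d x. r > 0 \<Longrightarrow> F (\<lambda>i. r * c i) d x = r powr p * F c d x"
    "\<And>c x. linear_coords (\<lambda>d. F c d x)"
    using assms(1) by (rule pairing_fieldE) blast
  obtain G where G:
    "\<And>c d v \<eta> x. represents c v \<Longrightarrow> represents d \<eta> \<Longrightarrow> x \<in> I \<Longrightarrow> g v \<eta> x = G c d x"
    "\<And>d. continuous_on UNIV (\<lambda>z. G (fst z) d (snd z))"
    "\<And>r c d x. r > 0 \<Longrightarrow> G (\<lambda>i. r * c i) d x = r powr p * G c d x"
    "\<And>c x. linear_coords (\<lambda>d. G c d x)"
    using assms(2) by (rule pairing_fieldE) blast
  show ?thesis
    by (intro pairing_fieldI[where G = "\<lambda>c d x. F c d x + G c d x"])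
       (use F G in \<open>auto intro!: continuous_on_add simp: linear_coords_def algebra_simps\<close>)
qed

lemma pairing_field_scale:
  assumes "pairing_field p I f"
  shows "pairing_field p I (\<lambda>v \<eta> x. s * f v \<eta> x)"
proof -
  obtain F where F:
    "\<And>c d v \<eta> x. represents c v \<Longrightarrow> represents d \<eta> \<Longrightarrow> x \<in> I \<Longrightarrow> f v \<eta> x = F c d x"
    "\<And>d. continuous_on UNIV (\<lambda>z. F (fst z) d (snd z))"
    "\<And>r c d x. r > 0 \<Longrightarrow> F (\<lambda>i. r * c i) d x = r powr p * F c d x"
    "\<And>c x. linear_coords (\<lambda>d. F c d x)"
    using assms by (rule pairing_fieldE) blast
  show ?thesis
    by (intro pairing_fieldI[where G = "\<lambda>c d x. s * F c d x"])
       (use F in \<open>auto intro!: continuous_on_mult_left simp: linear_coords_def algebra_simps\<close>)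
qed

lemma pairing_field_diff:
  assumes "pairing_field p I f" "pairing_field p I g"
  shows "pairing_field p I (\<lambda>v \<eta> x. f v \<eta> x - g v \<eta> x)"
  using pairing_field_add[OF assms(1) pairing_field_scale[OF assms(2), of "-1"]] by simp

lemma homogeneous_functional_add:
  assumes "homogeneous_functional p B" "homogeneous_functional p B'"
  shows "homogeneous_functional p (\<lambda>v \<eta>. B v \<eta> + B' v \<eta>)"
proof -
  obtain Q where Q: "homogeneous_form p Q"
    "\<And>c d v \<eta>. represents c v \<Longrightarrow> represents d \<eta> \<Longrightarrow> B v \<eta> = Q c d"
    using assms(1) unfolding homogeneous_functional_def by blast
  obtain Q' where Q': "homogeneous_form p Q'"
    "\<And>c d v \<eta>. represents c v \<Longrightarrow> represents d \<eta> \<Longrightarrow> B' v \<eta> = Q' c d"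
    using assms(2) unfolding homogeneous_functional_def by blast
  show ?thesis
    unfolding homogeneous_functional_def
    by (intro exI[of _ "\<lambda>c d. Q c d + Q' c d"] conjI homogeneous_form_add Q(1) Q'(1)) (simp add: Q(2) Q'(2))
qed

lemma homogeneous_functional_scale:
  "homogeneous_functional p B \<Longrightarrow> homogeneous_functional p (\<lambda>v \<eta>. s * B v \<eta>)"
proof -
  assume "homogeneous_functional p B"
  then obtain Q where Q: "homogeneous_form p Q"
    "\<And>c d v \<eta>. represents c v \<Longrightarrow> represents d \<eta> \<Longrightarrow> B v \<eta> = Q c d"
    unfolding homogeneous_functional_def by blast
  show ?thesis
    unfolding homogeneous_functional_def
    by (intro exI[of _ "\<lambda>c d. s * Q c d"] conjI homogeneous_form_scale Q(1)) (simp add: Q(2))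
qed

lemma homogeneous_functional_sum:
  assumes "\<And>i. i \<in> I \<Longrightarrow> homogeneous_functional p (B i)"
  shows "homogeneous_functional p (\<lambda>v \<eta>. \<Sum>i\<in>I. B i v \<eta>)"
proof -
  have "\<forall>i\<in>I. \<exists>Q. homogeneous_form p Q \<and>
     (\<forall>c d v \<eta>. represents c v \<longrightarrow> represents d \<eta> \<longrightarrow> B i v \<eta> = Q c d)"
    using assms by (auto simp: homogeneous_functional_def)
  then obtain Q where Q: "\<forall>i\<in>I. homogeneous_form p (Q i) \<and>
     (\<forall>c d v \<eta>. represents c v \<longrightarrow> represents d \<eta> \<longrightarrow> B i v \<eta> = Q i c d)"
    by (rule bchoice[THEN exE])
  show ?thesis
    unfolding homogeneous_functional_def
    by (intro exI[of _ "\<lambda>c d. \<Sum>i\<in>I. Q i c d"] conjI homogeneous_form_sum)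
       (use Q in \<open>auto intro!: sum.cong\<close>)
qed

text \<open>Cell boundaries are null sets, and off them each point of S lies in exactly one cell.
  There g coincides with the finite sum of the continuous pieces cut off by indicators.\<close>

lemma cell_integral:
  fixes g :: "real^2 \<Rightarrow> real"
  assumes S: "S \<in> sets lebesgue" "bounded S" "S \<subseteq> \<Union>T"
    and G: "\<And>K. K \<in> T \<Longrightarrow> continuous_on UNIV (G K)"
    and eq: "\<And>K x. K \<in> T \<Longrightarrow> x \<in> interior K \<Longrightarrow> g x = G K x"
  shows "set_integrable lebesgue S g" "(LINT x:S|lebesgue. g x) = (\<Sum>K\<in>T. LINT x:S \<inter> K|lebesgue. G K x)"
proof -
  let ?N = "\<Union>K\<in>T. frontier K"
  let ?g = "\<lambda>x. \<Sum>K\<in>T. indicator K x * G K x"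
  have N: "negligible ?N"
    using finite_cells cell by (intro negligible_Union) (auto intro!: negligible_convex_frontier)
  have SK: "S \<inter> K \<in> sets lebesgue" "bounded (S \<inter> K)" if "K \<in> T" for K
    using S cell(3)[OF that] by (auto simp: bounded_Int borel_closed)
  have int: "set_integrable lebesgue S (\<lambda>x. indicator K x * G K x)"
    and val: "(LINT x:S|lebesgue. indicator K x * G K x) = (LINT x:S \<inter> K|lebesgue. G K x)"
    if "K \<in> T" for K
    using set_integrable_continuous_bounded[OF G[OF that] SK[OF that]]
    by (simp_all add: set_integrable_def set_lebesgue_integral_def indicator_inter_arith mult.assoc)
  have intg: "set_integrable lebesgue S ?g"
    using int unfolding set_integrable_def scaleR_sum_right
    by (intro Bochner_Integration.integrable_sum)
  have eq': "g x = ?g x" if x: "x \<in> S - ?N" for x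
  proof -
    obtain K0 where K0: "K0 \<in> T" "x \<in> K0" using x S(3) by auto
    have in_int: "x \<in> interior K" if "K \<in> T" "x \<in> K" for K
      using x that cell(3)[OF that(1)] by (auto simp: frontier_def)
    \<comment> \<open>Off the frontiers a point of a cell is interior to it, and distinct cells have
      disjoint interiors.\<close>
    have uniq: "K = K0" if "K \<in> T" "x \<in> K" for K
      using in_int[OF that] in_int[OF K0] interiors_disjoint[OF that(1) K0(1)] by blast
    have "indicator K x * G K x = (if K = K0 then G K0 x else 0)" if "K \<in> T" for K
      using uniq[OF that] K0 by (cases "x \<in> K") auto
    then have "?g x = (\<Sum>K\<in>T. if K = K0 then G K0 x else 0)"
      by (rule sum.cong[OF refl])
    also have "\<dots> = G K0 x" using K0 finite_cells by simp
    finally show ?thesis using eq[OF K0(1) in_int[OF K0]] by simp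
  qed
  show "set_integrable lebesgue S g"
    by (rule lebesgue_spike(1)[OF N eq' intg])
  have "(LINT x:S|lebesgue. g x) = (LINT x:S|lebesgue. ?g x)"
    by (rule lebesgue_spike(2)[OF N eq' intg])
  also have "\<dots> = (\<Sum>K\<in>T. LINT x:S|lebesgue. indicator K x * G K x)"
    using int unfolding set_integrable_def set_lebesgue_integral_def scaleR_sum_right
    by (rule Bochner_Integration.integral_sum)
  finally show "(LINT x:S|lebesgue. g x) = (\<Sum>K\<in>T. LINT x:S \<inter> K|lebesgue. G K x)"
    using val by simp
qed

lemma homogeneous_functional_integral:
  assumes S: "S \<in> sets lebesgue" "bounded S" "S \<subseteq> \<Union>T"
    and g: "\<And>K. K \<in> T \<Longrightarrow> pairing_field p (interior K) g"
  shows "homogeneous_functional p (\<lambda>v \<eta>. LINT x:S|lebesgue. g v \<eta> x)"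
    and "represents c v \<Longrightarrow> represents d \<eta> \<Longrightarrow> set_integrable lebesgue S (g v \<eta>)"
proof -
  have "\<forall>K\<in>T. \<exists>G.
     (\<forall>c d v \<eta>. represents c v \<longrightarrow> represents d \<eta> \<longrightarrow> (\<forall>x\<in>interior K. g v \<eta> x = G c d x)) \<and>
     (\<forall>d. continuous_on UNIV (\<lambda>z. G (fst z) d (snd z))) \<and>
     (\<forall>r>0. \<forall>c d x. G (\<lambda>i. r * c i) d x = r powr p * G c d x) \<and>
     (\<forall>c x. linear_coords (\<lambda>d. G c d x))"
    using g unfolding pairing_field_def by simp
  then obtain G where G: "\<forall>K\<in>T.
     (\<forall>c d v \<eta>. represents c v \<longrightarrow> represents d \<eta> \<longrightarrow> (\<forall>x\<in>interior K. g v \<eta> x = G K c d x)) \<and>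
     (\<forall>d. continuous_on UNIV (\<lambda>z. G K (fst z) d (snd z))) \<and>
     (\<forall>r>0. \<forall>c d x. G K (\<lambda>i. r * c i) d x = r powr p * G K c d x) \<and>
     (\<forall>c x. linear_coords (\<lambda>d. G K c d x))"
    by (rule bchoice[THEN exE])
  have Gc: "continuous_on UNIV (G K c d)" if "K \<in> T" for K c d
    using continuous_on_compose2[of UNIV "\<lambda>z. G K (fst z) d (snd z)" UNIV "\<lambda>x. (c, x)"] G that
    by (simp add: continuous_intros)
  have SK: "S \<inter> K \<in> sets lebesgue" "bounded (S \<inter> K)" if "K \<in> T" for K
    using S cell(3)[OF that] by (auto simp: bounded_Int borel_closed)
  show "represents c v \<Longrightarrow> represents d \<eta> \<Longrightarrow> set_integrable lebesgue S (g v \<eta>)"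
    by (rule cell_integral(1)[OF S, of "\<lambda>K. G K c d"]) (use G Gc in auto)
  have "(LINT x:S|lebesgue. g v \<eta> x) = (\<Sum>K\<in>T. LINT x:S \<inter> K|lebesgue. G K c d x)"
    if "represents c v" "represents d \<eta>" for c d v \<eta>
    by (rule cell_integral(2)[OF S]) (use G Gc that in auto)
  moreover have "homogeneous_form p (\<lambda>c d. \<Sum>K\<in>T. LINT x:S \<inter> K|lebesgue. G K c d x)"
    by (intro homogeneous_form_sum homogeneous_form_integral) (use G SK in auto)
  ultimately show "homogeneous_functional p (\<lambda>v \<eta>. LINT x:S|lebesgue. g v \<eta> x)"
    unfolding homogeneous_functional_def by blast
qed

lemma homogeneous_functional_edge_integral:
  assumes seg: "E = closed_segment a b" and g: "pairing_field p E g"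
  shows "homogeneous_functional p (\<lambda>v \<eta>. edge_integral E (g v \<eta>))"
proof -
  \<comment> \<open>The endpoints picked by \<open>SOME\<close> may differ from a and b, but depend
    on E alone. Fixing them once serves every integrand.\<close>
  obtain a' b' where ab: "(SOME (a, b). E = closed_segment a b) = (a', b')"
    by (rule prod.exhaust)
  have "case (SOME (a, b). E = closed_segment a b) of (a, b) \<Rightarrow> E = closed_segment a b"
    by (rule someI[of _ "(a, b)"]) (simp add: seg)
  then have E: "E = closed_segment a' b'" unfolding ab by simp
  have ei: "edge_integral E k = dist a' b' * (LINT t:{0..1}|lebesgue. k (linepath a' b' t))" for k
    by (simp add: edge_integral_def ab)
  obtain G where G:
    "\<And>c d v \<eta> x. represents c v \<Longrightarrow> represents d \<eta> \<Longrightarrow> x \<in> E \<Longrightarrow> g v \<eta> x = G c d x"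
    "\<And>d. continuous_on UNIV (\<lambda>z. G (fst z) d (snd z))"
    "\<And>r c d x. r > 0 \<Longrightarrow> G (\<lambda>i. r * c i) d x = r powr p * G c d x"
    "\<And>c x. linear_coords (\<lambda>d. G c d x)"
    using g by (rule pairing_fieldE) blast
  have "continuous_on UNIV (\<lambda>z :: (nat \<Rightarrow> real) \<times> real. (fst z, linepath a' b' (snd z)))"
    unfolding linepath_def by (intro continuous_intros)
  then have "continuous_on UNIV (\<lambda>z. G (fst z) d (linepath a' b' (snd z)))" for d
    using continuous_on_compose2[OF G(2)[of d]] by fastforce
  then have "homogeneous_form p (\<lambda>c d. dist a' b' * (LINT t:{0..1}|lebesgue. G c d (linepath a' b' t)))"
    using G by (intro homogeneous_form_scale homogeneous_form_integral) auto
  moreover have "edge_integral E (g v \<eta>) = dist a' b' * (LINT t:{0..1}|lebesgue. G c d (linepath a' b' t))"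
    if "represents c v" "represents d \<eta>" for c d v \<eta>
  proof -
    have "linepath a' b' t \<in> E" if "t \<in> {0..1}" for t
      using that by (auto simp: E linepath_in_path)
    then have "(LINT t:{0..1}|lebesgue. g v \<eta> (linepath a' b' t)) = (LINT t:{0..1}|lebesgue. G c d (linepath a' b' t))"
      using G(1)[OF that] by (intro set_lebesgue_integral_cong) auto
    then show ?thesis by (simp add: ei)
  qed
  ultimately show ?thesis
    unfolding homogeneous_functional_def by blast
qed

section \<open>Traces and edges\<close>

lemma trace_represents:
  "represents c v \<Longrightarrow> K \<in> T \<Longrightarrow> x \<in> K \<Longrightarrow> trace K v x = cell_poly c (h K) x"
  by (rule trace_eq) (auto simp: cell represents_def continuous_cell_poly_space)

lemma grad_represents:
  assumes "represents c v" "K \<in> T" "x \<in> interior K"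
  shows "grad v x = cell_grad c (h K) x"
  using assms by (intro grad_eq[OF open_interior _ _ GDERIV_cell_poly]) (auto simp: represents_def)

lemma trace_grad_represents:
  "represents c v \<Longrightarrow> K \<in> T \<Longrightarrow> x \<in> K \<Longrightarrow> trace K (grad v) x = cell_grad c (h K) x"
  by (rule trace_eq) (auto simp: cell grad_represents continuous_cell_grad_space)

lemma trace_dpow_represents:
  assumes "\<delta> \<ge> 1" "represents c v" "K \<in> T" "x \<in> K"
  shows "trace K (\<lambda>x. vector [dpow \<delta> (v x), dpow \<delta> (v x)] :: real^2) x
    = vector [dpow \<delta> (cell_poly c (h K) x), dpow \<delta> (cell_poly c (h K) x)]"
proof (rule trace_eq[OF cell(1,3,4)])
  have "continuous_on UNIV (\<lambda>x. dpow \<delta> (cell_poly c (h K) x))"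
    by (rule continuous_on_compose2[OF continuous_dpow[OF assms(1)] continuous_cell_poly_space]) simp
  then show "continuous_on UNIV (\<lambda>x. vector [dpow \<delta> (cell_poly c (h K) x), dpow \<delta> (cell_poly c (h K) x)] :: real^2)"
    by (rule continuous_on_vector_2[OF _ \<open>continuous_on UNIV _\<close>])
qed (use assms in \<open>auto simp: represents_def\<close>)

lemma linear_field_eval: "K \<in> T \<Longrightarrow> linear_field (interior K) (\<lambda>v x. v x)"
  by (rule linear_fieldI[where G = "\<lambda>c x. cell_poly c (h K) x"])
     (auto simp: represents_def continuous_cell_poly linear_cell_poly)

lemma linear_field_trace: "K \<in> T \<Longrightarrow> I \<subseteq> K \<Longrightarrow> linear_field I (\<lambda>v x. trace K v x)"
  by (rule linear_fieldI[where G = "\<lambda>c x. cell_poly c (h K) x"])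
     (auto simp: trace_represents continuous_cell_poly linear_cell_poly)

lemma linear_field_grad: "K \<in> T \<Longrightarrow> linear_field (interior K) (\<lambda>v x. grad v x \<bullet> n)"
  by (rule linear_fieldI[where G = "\<lambda>c x. cell_grad c (h K) x \<bullet> n"])
     (auto simp: grad_represents continuous_cell_grad linear_cell_grad)

lemma linear_field_trace_grad: "K \<in> T \<Longrightarrow> I \<subseteq> K \<Longrightarrow> linear_field I (\<lambda>v x. trace K (grad v) x \<bullet> n)"
  by (rule linear_fieldI[where G = "\<lambda>c x. cell_grad c (h K) x \<bullet> n"])
     (auto simp: trace_grad_represents continuous_cell_grad linear_cell_grad)

lemma linear_field_trace_grad_sum:
  assumes "K \<in> T" "I \<subseteq> K" "K' \<in> T" "I \<subseteq> K'"
  shows "linear_field I (\<lambda>v x. (trace K (grad v) x + trace K' (grad v) x) \<bullet> n)"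
  unfolding inner_add_left by (intro linear_field_add linear_field_trace_grad assms)

text \<open>The two components of the convecting field agree, so its product with n is n_1 + n_2
  times one scalar. By continuity of \<open>dpow\<close>, the trace of the power is the power of the
  trace.\<close>

lemma homogeneous_field_trace_dpow:
  assumes "\<delta> \<ge> 1" "K \<in> T" "I \<subseteq> K"
  shows "homogeneous_field \<delta> I (\<lambda>v x. trace K (\<lambda>y. vector [dpow \<delta> (v y), dpow \<delta> (v y)]) x \<bullet> (n :: real^2))"
proof (rule homogeneous_field_cong)
  show "homogeneous_field \<delta> I (\<lambda>v x. (n $ 1 + n $ 2) * dpow \<delta> (trace K v x))"
    by (intro homogeneous_field_scale homogeneous_field_dpow homogeneous_field_linear linear_field_trace assms)
  show "trace K (\<lambda>y. vector [dpow \<delta> (v y), dpow \<delta> (v y)]) x \<bullet> n = (n $ 1 + n $ 2) * dpow \<delta> (trace K v x)"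
    if "represents c v" "x \<in> I" for c v x
    using that assms
    by (simp add: trace_dpow_represents trace_represents subset_iff inner_vec_def sum_2 algebra_simps)
qed

lemma segment_aff_dim_1:
  fixes E :: "(real^2) set"
  assumes "compact E" "connected E" "aff_dim E = 1"
  shows "\<exists>a b. a \<noteq> b \<and> E = closed_segment a b"
proof -
  have "collinear E" "E \<noteq> {}" using assms by (auto simp: collinear_aff_dim)
  then obtain a b where ab: "E = closed_segment a b"
    using compact_convex_collinear_segment_alt assms by blast
  then have "a \<noteq> b" using assms by auto
  then show ?thesis using ab by blast
qed

lemma interior_edge_segment:
  assumes "E \<in> interior_edges T"
  shows "\<exists>a b. a \<noteq> b \<and> E = closed_segment a b"
proof -
  obtain K K' where "K \<in> T" "K' \<in> T" "E = K \<inter> K'" "aff_dim E = 1"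
    using assms by (auto simp: interior_edges_def)
  moreover from this have "compact E" "convex E"
    by (simp_all add: compact_Int convex_Int cell(1,2))
  ultimately show ?thesis
    by (intro segment_aff_dim_1 convex_connected)
qed

lemma boundary_edge:
  assumes "E \<in> boundary_edges \<Omega> T"
  shows "\<exists>a b. a \<noteq> b \<and> E = closed_segment a b" "\<exists>K\<in>T. E \<subseteq> K"
proof -
  obtain K S where K: "K \<in> T" "S edge_of K" and E: "E \<in> components (S \<inter> frontier \<Omega>)" "aff_dim E = 1"
    using assms by (auto simp: boundary_edges_def)
  have "S face_of K" using K by (simp add: edge_of_def)
  then have "compact S" using cell[OF K(1)] by (auto intro: face_of_imp_compact)
  then have "compact (S \<inter> frontier \<Omega>)" by (simp add: compact_Int_closed)
  then have "compact E"
    using E(1) compact_components by blast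
  moreover have "connected E" using E(1) in_components_connected by blast
  ultimately show "\<exists>a b. a \<noteq> b \<and> E = closed_segment a b"
    using E(2) by (intro segment_aff_dim_1)
  show "\<exists>K\<in>T. E \<subseteq> K"
    using in_components_subset[OF E(1)] edge_of_imp_subset[OF K(2)] K(1) by blast
qed

lemma edge_segment: "E \<in> edges \<Omega> T \<Longrightarrow> \<exists>a b. E = closed_segment a b"
  using interior_edge_segment boundary_edge(1) unfolding edges_def by blast

lemma plus_cell:
  assumes "E \<in> edges \<Omega> T"
  shows "plus_cell T E \<in> T" "E \<subseteq> plus_cell T E"
proof -
  have "\<exists>K. K \<in> T \<and> E \<subseteq> K"
    using assms boundary_edge(2) by (auto simp: edges_def interior_edges_def)
  from someI_ex[OF this] show "plus_cell T E \<in> T" "E \<subseteq> plus_cell T E"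
    by (simp_all add: plus_cell_def)
qed

text \<open>The choice in \<open>neighbour\<close> is meaningful only if some other cell meets K
  exactly in E. If K were neither of the two cells whose intersection is E, three cells with
  disjoint interiors would share a segment.\<close>

lemma neighbour:
  assumes E: "E \<in> interior_edges T" and K: "K \<in> T" "E \<subseteq> K"
  shows "neighbour T K E \<in> T" "E \<subseteq> neighbour T K E"
proof -
  obtain a b where ab: "a \<noteq> b" "E = closed_segment a b"
    using interior_edge_segment[OF E] by blast
  obtain K1 K2 where K12: "K1 \<in> T" "K2 \<in> T" "K1 \<noteq> K2" "E = K1 \<inter> K2"
    using E by (auto simp: interior_edges_def)
  have "K = K1 \<or> K = K2"
  proof (rule ccontr)
    assume "\<not> ?thesis"
    then have "interior K1 \<inter> interior K2 = {}" "interior K1 \<inter> interior K = {}" "interior K2 \<inter> interior K = {}"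
      using K12 K interiors_disjoint by metis+
    moreover have "closed_segment a b \<subseteq> K1" "closed_segment a b \<subseteq> K2" "closed_segment a b \<subseteq> K"
      using ab(2) K12(4) K(2) by auto
    ultimately show False
      using three_convex_sets_common_segment[OF ab(1), of K1 K2 K] cell K12(1,2) K(1) by metis
  qed
  then have "\<exists>K'. K' \<in> T \<and> K' \<noteq> K \<and> E = K \<inter> K'"
    using K12 by (metis Int_commute)
  from someI_ex[OF this] show "neighbour T K E \<in> T" "E \<subseteq> neighbour T K E"
    by (auto simp: neighbour_def)
qed

lemma interior_edge_cells:
  assumes "E \<in> interior_edges T"
  shows "plus_cell T E \<in> T" "E \<subseteq> plus_cell T E" "minus_cell T E \<in> T" "E \<subseteq> minus_cell T E"
  using plus_cell[of E] neighbour[OF assms, of "plus_cell T E"] assms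
  by (auto simp: edges_def minus_cell_def)

lemma linear_field_jump:
  assumes "E \<in> edges \<Omega> T"
  shows "linear_field E (\<lambda>v x. jump T E v x)"
proof (cases "E \<in> interior_edges T")
  case True
  then show ?thesis
    unfolding jump_def by (simp add: linear_field_diff linear_field_trace interior_edge_cells)
next
  case False
  then show ?thesis
    unfolding jump_def by (simp add: linear_field_trace plus_cell[OF assms])
qed

lemma linear_field_outer_trace:
  assumes "K \<in> T" "E \<subseteq> K"
  shows "linear_field E (\<lambda>v x. outer_trace T K E v x)"
  unfolding outer_trace_def
  by (cases "E \<in> interior_edges T") (simp_all add: linear_field_trace linear_field_0 neighbour assms)

lemma homogeneous_functional_edge:
  assumes "E \<in> edges \<Omega> T" "pairing_field p E g"
  shows "homogeneous_functional p (\<lambda>v \<eta>. edge_integral E (g v \<eta>))"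
  using edge_segment[OF assms(1)] homogeneous_functional_edge_integral[OF _ assms(2)] by blast

lemma homogeneous_functional_cell:
  assumes "K \<in> T" "\<And>K. K \<in> T \<Longrightarrow> pairing_field p (interior K) g"
  shows "homogeneous_functional p (\<lambda>v \<eta>. LINT x:K|lebesgue. g v \<eta> x)"
  using assms cell(3)[OF assms(1)] cell(5)[OF assms(1)]
  by (intro homogeneous_functional_integral(1)) (auto simp: borel_closed)

section \<open>Degrees of the diffusion and convection forms\<close>

lemma homogeneous_functional_a_DG: "homogeneous_functional 1 (\<lambda>u v. a_DG \<Omega> T \<sigma> u v)"
proof -
  have vol: "pairing_field 1 (interior K) (\<lambda>u v x. grad u x \<bullet> grad v x)" if "K \<in> T" for K
  proof -
    \<comment> \<open>The calculus covers scalar products of fields only, so the gradients are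
      paired coordinate by coordinate.\<close>
    have "grad u x \<bullet> grad v x = (grad u x \<bullet> axis 1 1) * (grad v x \<bullet> axis 1 1)
        + (grad u x \<bullet> axis 2 1) * (grad v x \<bullet> axis 2 1)" for u v x
      by (simp add: inner_vec_def[of "grad u x" "grad v x"] sum_2 inner_axis)
    then show ?thesis
      by (simp only:)
         (intro pairing_field_add pairing_field_mult homogeneous_field_linear linear_field_grad that)
  qed
  show ?thesis
    unfolding a_DG_def Let_def
  proof (intro homogeneous_functional_add homogeneous_functional_sum)
    show "homogeneous_functional 1 (\<lambda>u v. LINT x:K|lebesgue. grad u x \<bullet> grad v x)" if "K \<in> T" for K
      using that vol by (rule homogeneous_functional_cell)
  next
    fix E assume int: "E \<in> interior_edges T"
    then have E: "E \<in> edges \<Omega> T" by (simp add: edges_def)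
    show "homogeneous_functional 1 (\<lambda>u v. edge_integral E (\<lambda>x.
             \<sigma> / diameter E * jump T E u x * jump T E v x
           - 1/2 * ((trace (plus_cell T E) (grad u) x + trace (minus_cell T E) (grad u) x)
               \<bullet> outward_normal (plus_cell T E) E) * jump T E v x
           - 1/2 * ((trace (plus_cell T E) (grad v) x + trace (minus_cell T E) (grad v) x)
               \<bullet> outward_normal (plus_cell T E) E) * jump T E u x))"
      by (rule homogeneous_functional_edge[OF E], intro pairing_field_diff;
          intro pairing_field_mult pairing_field_mult_swap linear_field_scale homogeneous_field_scale
            homogeneous_field_linear linear_field_jump linear_field_trace_grad_sum interior_edge_cells E int)
  next
    fix E assume "E \<in> boundary_edges \<Omega> T"
    then have E: "E \<in> edges \<Omega> T" by (simp add: edges_def)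
    show "homogeneous_functional 1 (\<lambda>u v. edge_integral E (\<lambda>x.
             2 * \<sigma> / diameter E * trace (plus_cell T E) u x * trace (plus_cell T E) v x
           - (trace (plus_cell T E) (grad u) x \<bullet> outward_normal (plus_cell T E) E) * trace (plus_cell T E) v x
           - (trace (plus_cell T E) (grad v) x \<bullet> outward_normal (plus_cell T E) E) * trace (plus_cell T E) u x))"
      by (rule homogeneous_functional_edge[OF E], intro pairing_field_diff;
          intro pairing_field_mult pairing_field_mult_swap linear_field_scale homogeneous_field_scale
            homogeneous_field_linear linear_field_trace linear_field_trace_grad plus_cell E)
  qed
qed

text \<open>The convecting field contributes \<delta> to the degree, also under the modulus of the
  upwind term, and the convected function contributes 1.\<close>

lemma homogeneous_functional_b_DG:
  assumes "\<delta> \<ge> 1"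
  shows "homogeneous_functional (\<delta> + 1)
    (\<lambda>u v. b_DG \<Omega> T (\<lambda>x. vector [dpow \<delta> (u x), dpow \<delta> (u x)]) u v)"
proof -
  have vol: "pairing_field (\<delta> + 1) (interior K)
      (\<lambda>u v x. (vector [dpow \<delta> (u x), dpow \<delta> (u x)] \<bullet> grad u x) * v x)" if "K \<in> T" for K
  proof -
    have "(vector [dpow \<delta> (u x), dpow \<delta> (u x)] :: real^2) \<bullet> grad u x
        = dpow \<delta> (u x) * (grad u x \<bullet> vector [1, 1])" for u x
      by (simp add: inner_vec_def sum_2 algebra_simps)
    then show ?thesis
      by (simp only:)
         (intro pairing_field_mult homogeneous_field_mult homogeneous_field_dpow
          homogeneous_field_linear linear_field_grad linear_field_eval that assms)
  qed
  show ?thesis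
    unfolding b_DG_def Let_def
  proof (intro homogeneous_functional_add homogeneous_functional_scale homogeneous_functional_sum)
    show "homogeneous_functional (\<delta> + 1)
       (\<lambda>u v. LINT x:K|lebesgue. (vector [dpow \<delta> (u x), dpow \<delta> (u x)] \<bullet> grad u x) * v x)"
      if "K \<in> T" for K
      using that vol by (rule homogeneous_functional_cell)
  next
    fix K E assume K: "K \<in> T" and "E \<in> {E \<in> edges \<Omega> T. E \<subseteq> K}"
    then have E: "E \<in> edges \<Omega> T" "E \<subseteq> K" by auto
    show "homogeneous_functional (\<delta> + 1) (\<lambda>u v. edge_integral E (\<lambda>x.
             ((trace K (\<lambda>x. vector [dpow \<delta> (u x), dpow \<delta> (u x)]) x \<bullet> outward_normal K E)
                * (outer_trace T K E u x - trace K u x)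
              - \<bar>trace K (\<lambda>x. vector [dpow \<delta> (u x), dpow \<delta> (u x)]) x \<bullet> outward_normal K E\<bar>
                * (outer_trace T K E u x - trace K u x)) * trace K v x))"
      by (intro homogeneous_functional_edge pairing_field_mult homogeneous_field_diff[of "\<delta> + 1"]
          homogeneous_field_mult homogeneous_field_abs homogeneous_field_trace_dpow
          homogeneous_field_linear linear_field_diff linear_field_trace linear_field_outer_trace E K assms)
  qed
qed

section \<open>Solvability\<close>

lemma lebesgue_domain: "\<Omega> \<in> sets lebesgue"
  using open_domain by simp

lemma homogeneous_functional_domain:
  assumes "\<And>K. K \<in> T \<Longrightarrow> pairing_field p (interior K) g"
  shows "homogeneous_functional p (\<lambda>v \<eta>. LINT x:\<Omega>|lebesgue. g v \<eta> x)"
    and "represents c v \<Longrightarrow> represents d \<eta> \<Longrightarrow> set_integrable lebesgue \<Omega> (g v \<eta>)"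
  using homogeneous_functional_integral[OF lebesgue_domain bounded_domain domain_subset_cells assms]
  by auto

text \<open>The contribution of the k-th power of v^\<delta> when the reaction term is expanded; k
  is 0, 1 or 2.\<close>

definition reaction :: "nat \<Rightarrow> real \<Rightarrow> (real^2 \<Rightarrow> real) \<Rightarrow> (real^2 \<Rightarrow> real) \<Rightarrow> real" where
  "reaction k \<delta> v \<eta> = (LINT x:\<Omega>|lebesgue. v x * dpow \<delta> (v x) ^ k * \<eta> x)"

lemma reaction:
  assumes "\<delta> \<ge> 1"
  shows "homogeneous_functional (real k * \<delta> + 1) (reaction k \<delta>)"
    and "represents c v \<Longrightarrow> represents d \<eta> \<Longrightarrow>
      set_integrable lebesgue \<Omega> (\<lambda>x. v x * dpow \<delta> (v x) ^ k * \<eta> x)"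
proof -
  have "homogeneous_field (real k * \<delta> + 1) (interior K) (\<lambda>v x. v x * dpow \<delta> (v x) ^ k)" if "K \<in> T" for K
  proof (induction k)
    case 0
    show ?case using homogeneous_field_linear[OF linear_field_eval[OF that]] by simp
  next
    case (Suc k)
    have "homogeneous_field ((real k * \<delta> + 1) + \<delta>) (interior K)
        (\<lambda>v x. (v x * dpow \<delta> (v x) ^ k) * dpow \<delta> (v x))"
      by (intro homogeneous_field_mult Suc homogeneous_field_dpow assms homogeneous_field_linear
          linear_field_eval that)
    moreover have "(real k * \<delta> + 1) + \<delta> = real (Suc k) * \<delta> + 1"
      by (simp add: algebra_simps)
    ultimately show ?case
      by (simp only: power_Suc2 mult.assoc)
  qed
  then have *: "pairing_field (real k * \<delta> + 1) (interior K) (\<lambda>v \<eta> x. v x * dpow \<delta> (v x) ^ k * \<eta> x)"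
    if "K \<in> T" for K
    using that by (intro pairing_field_mult linear_field_eval)
  show "homogeneous_functional (real k * \<delta> + 1) (reaction k \<delta>)"
    using homogeneous_functional_domain(1)[OF *] by (simp add: reaction_def[abs_def])
  show "represents c v \<Longrightarrow> represents d \<eta> \<Longrightarrow>
      set_integrable lebesgue \<Omega> (\<lambda>x. v x * dpow \<delta> (v x) ^ k * \<eta> x)"
    by (rule homogeneous_functional_domain(2)[OF *])
qed

text \<open>With w = v^\<delta>, (1 - w) (w - \<gamma>) = (1 + \<gamma>) w - \<gamma> - w^2. The
  three groups have degrees 1, \<delta> + 1 and 2 \<delta> + 1 in v, and the minus sign in front of
  the reaction makes the last one positive.\<close>

lemma A_DG_by_degree:
  assumes "\<delta> \<ge> 1" "represents c v" "represents d \<eta>"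
  shows "A_DG \<Omega> T \<sigma> \<nu> \<alpha> \<beta> \<gamma> \<delta> v \<eta> =
     (\<nu> * a_DG \<Omega> T \<sigma> v \<eta> + \<beta> * \<gamma> * reaction 0 \<delta> v \<eta>)
   + (\<alpha> * b_DG \<Omega> T (\<lambda>x. vector [dpow \<delta> (v x), dpow \<delta> (v x)]) v \<eta> + - (\<beta> * (1 + \<gamma>)) * reaction 1 \<delta> v \<eta>)
   + \<beta> * reaction 2 \<delta> v \<eta>"
proof -
  let ?g = "\<lambda>k x. v x * dpow \<delta> (v x) ^ k * \<eta> x"
  note int = reaction(2)[OF assms]
  have "L2_inner \<Omega> (\<lambda>x. v x * (1 - dpow \<delta> (v x)) * (dpow \<delta> (v x) - \<gamma>)) \<eta>
      = (LINT x:\<Omega>|lebesgue. (1 + \<gamma>) * ?g 1 x - \<gamma> * ?g 0 x - ?g 2 x)"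
    unfolding L2_inner_def
    by (rule arg_cong[where f = "set_lebesgue_integral lebesgue \<Omega>"])
       (simp add: fun_eq_iff power2_eq_square algebra_simps)
  also have "\<dots> = (LINT x:\<Omega>|lebesgue. (1 + \<gamma>) * ?g 1 x) - (LINT x:\<Omega>|lebesgue. \<gamma> * ?g 0 x)
      - (LINT x:\<Omega>|lebesgue. ?g 2 x)"
    using int by (subst set_integral_diff(2), (intro set_integral_diff(1) set_integrable_mult_right int)+)+ simp
  also have "\<dots> = (1 + \<gamma>) * reaction 1 \<delta> v \<eta> - \<gamma> * reaction 0 \<delta> v \<eta> - reaction 2 \<delta> v \<eta>"
    by (simp only: reaction_def set_integral_mult_right)
  finally have *: "L2_inner \<Omega> (\<lambda>x. v x * (1 - dpow \<delta> (v x)) * (dpow \<delta> (v x) - \<gamma>)) \<eta>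
      = (1 + \<gamma>) * reaction 1 \<delta> v \<eta> - \<gamma> * reaction 0 \<delta> v \<eta> - reaction 2 \<delta> v \<eta>" .
  show ?thesis
    unfolding A_DG_def * by (simp add: algebra_simps)
qed

text \<open>The canonical function with coefficients c. Using interiors prevents neighbouring
  polynomials from adding up on a common edge; on the skeleton the value is 0.\<close>

definition reconstruct :: "(nat \<Rightarrow> real) \<Rightarrow> real^2 \<Rightarrow> real" where
  "reconstruct c x = (\<Sum>K\<in>T. indicator (interior K) x * cell_poly c (h K) x)"

lemma represents_reconstruct: "represents c (reconstruct c)"
  unfolding represents_def
proof (intro ballI)
  fix K x assume K: "K \<in> T" and x: "x \<in> interior K"
  have "indicator (interior K') x * cell_poly c (h K') x = (if K' = K then cell_poly c (h K) x else 0)"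
    if "K' \<in> T" for K'
    using interiors_disjoint[OF that K] x by (cases "x \<in> interior K'") auto
  then have "reconstruct c x = (\<Sum>K'\<in>T. if K' = K then cell_poly c (h K) x else 0)"
    unfolding reconstruct_def by (rule sum.cong[OF refl])
  then show "reconstruct c x = cell_poly c (h K) x"
    using K finite_cells by simp
qed

lemma reconstruct_linear: "reconstruct (\<lambda>i. s * d i + d' i) x = s * reconstruct d x + reconstruct d' x"
  using linear_coordsD[OF linear_cell_poly]
  by (simp add: reconstruct_def sum_distrib_left algebra_simps flip: sum.distrib)

lemma represents_L2:
  assumes "represents c v"
  shows "v \<in> L2 \<Omega>"
proof -
  have "set_integrable lebesgue \<Omega> v"
    by (rule cell_integral(1)[OF lebesgue_domain bounded_domain domain_subset_cells,
          where G = "\<lambda>K. cell_poly c (h K)"])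
       (use assms continuous_cell_poly_space in \<open>auto simp: represents_def\<close>)
  then have "integrable (lebesgue_on \<Omega>) v"
    using lebesgue_domain by (simp add: integrable_restrict_space set_integrable_def)
  moreover have "set_integrable lebesgue \<Omega> (\<lambda>x. (v x)\<^sup>2)"
    by (rule cell_integral(1)[OF lebesgue_domain bounded_domain domain_subset_cells,
          where G = "\<lambda>K x. (cell_poly c (h K) x)\<^sup>2"])
       (use assms continuous_cell_poly_space in \<open>auto simp: represents_def intro!: continuous_intros\<close>)
  then have "integrable (lebesgue_on \<Omega>) (\<lambda>x. (v x)\<^sup>2)"
    using lebesgue_domain by (simp add: integrable_restrict_space set_integrable_def)
  ultimately show ?thesis
    by (auto simp: L2_def)
qed

lemma reconstruct_in_V_DG: "reconstruct c \<in> V_DG \<Omega> T"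
proof -
  have "cell_poly c j \<in> P1" for j
    unfolding P1_def cell_poly_def by blast
  then show ?thesis
    using represents_L2[OF represents_reconstruct] represents_reconstruct[of c]
    unfolding V_DG_def represents_def by blast
qed

lemma P1_eq_cell_poly:
  assumes "p \<in> P1"
  shows "\<exists>q. p = cell_poly q 0"
proof -
  obtain a b c d where p: "\<And>x. p x = a + b * x $ 1 + c * x $ 2 + d * x $ 1 * x $ 2"
    using assms unfolding P1_def by blast
  have "p x = cell_poly (\<lambda>i. if i = 0 then a else if i = 1 then b else if i = 2 then c else d) 0 x" for x
    unfolding p cell_poly_def by simp
  then show ?thesis by blast
qed

lemma V_DG_represented:
  assumes "\<eta> \<in> V_DG \<Omega> T"
  shows "\<exists>d. represents d \<eta> \<and> (\<forall>i\<ge>4 * card T. d i = 0)"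
proof -
  have "\<forall>K\<in>T. \<exists>q. \<forall>x\<in>interior K. \<eta> x = cell_poly q 0 x"
  proof
    fix K assume "K \<in> T"
    then have "\<exists>p\<in>P1. \<forall>x\<in>interior K. \<eta> x = p x"
      using assms by (simp add: V_DG_def)
    then obtain p where p: "p \<in> P1" "\<forall>x\<in>interior K. \<eta> x = p x" ..
    obtain q where "p = cell_poly q 0" using P1_eq_cell_poly[OF p(1)] ..
    then show "\<exists>q. \<forall>x\<in>interior K. \<eta> x = cell_poly q 0 x"
      using p(2) by (intro exI[of _ q]) simp
  qed
  then obtain q where q: "\<forall>K\<in>T. \<forall>x\<in>interior K. \<eta> x = cell_poly (q K) 0 x"
    by (rule bchoice[THEN exE])
  \<comment> \<open>The local coefficients \<open>q K\<close> sit in block 0 and are moved to the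
    block of K. The zero tail makes d admissible as a test vector in
    \<open>homogeneous_form_solvable\<close>.\<close>
  define d where "d = (\<lambda>i. if i < 4 * card T then q (inv_into T h (i div 4)) (i mod 4) else 0)"
  have d: "d (4 * h K + r) = q K r" if "K \<in> T" "r < 4" for K r
  proof -
    have "h K < card T" using bij_index that(1) by (auto simp: bij_betw_def)
    moreover have "inv_into T h (h K) = K"
      using bij_index that(1) by (simp add: bij_betw_def)
    ultimately show ?thesis using that(2) by (simp add: d_def)
  qed
  have "cell_poly d (h K) x = cell_poly (q K) 0 x" if "K \<in> T" for K x
    using d[OF that, of 0] d[OF that, of 1] d[OF that, of 2] d[OF that, of 3]
    by (simp add: cell_poly_def numeral_2_eq_2)
  then have "represents d \<eta>"
    using q by (simp add: represents_def)
  moreover have "\<forall>i\<ge>4 * card T. d i = 0" by (simp add: d_def)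
  ultimately show ?thesis by blast
qed

lemma set_integrable_L2_mult:
  assumes "f \<in> L2 \<Omega>" "g \<in> L2 \<Omega>"
  shows "set_integrable lebesgue \<Omega> (\<lambda>x. f x * g x)"
proof -
  have f: "f \<in> borel_measurable (lebesgue_on \<Omega>)" "integrable (lebesgue_on \<Omega>) (\<lambda>x. (f x)\<^sup>2)"
    and g: "g \<in> borel_measurable (lebesgue_on \<Omega>)" "integrable (lebesgue_on \<Omega>) (\<lambda>x. (g x)\<^sup>2)"
    using assms by (auto simp: L2_def)
  have "integrable (lebesgue_on \<Omega>) (\<lambda>x. f x * g x)"
  proof (rule Bochner_Integration.integrable_bound)
    show "integrable (lebesgue_on \<Omega>) (\<lambda>x. (f x)\<^sup>2 + (g x)\<^sup>2)"
      using f(2) g(2) by (rule Bochner_Integration.integrable_add)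
    show "(\<lambda>x. f x * g x) \<in> borel_measurable (lebesgue_on \<Omega>)"
      using f(1) g(1) by (rule borel_measurable_times)
    have "\<bar>a * b\<bar> \<le> a\<^sup>2 + b\<^sup>2" for a b :: real
    proof -
      have "2 * (\<bar>a\<bar> * \<bar>b\<bar>) \<le> a\<^sup>2 + b\<^sup>2"
        using sum_squares_bound[of "\<bar>a\<bar>" "\<bar>b\<bar>"] by simp
      moreover have "0 \<le> \<bar>a\<bar> * \<bar>b\<bar>" by simp
      ultimately show ?thesis unfolding abs_mult by linarith
    qed
    then show "AE x in lebesgue_on \<Omega>. norm (f x * g x) \<le> norm ((f x)\<^sup>2 + (g x)\<^sup>2)"
      by simp
  qed
  then show ?thesis
    using lebesgue_domain by (simp add: integrable_restrict_space set_integrable_def)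
qed

text \<open>Functions with the same coefficients agree on the domain off the cell frontiers, a null
  set, so the load becomes a linear functional of d.\<close>

lemma L2_inner_represented:
  assumes f: "f \<in> L2 \<Omega>"
  shows "linear_coords (\<lambda>d. L2_inner \<Omega> f (reconstruct d))"
    and "represents d \<eta> \<Longrightarrow> L2_inner \<Omega> f \<eta> = L2_inner \<Omega> f (reconstruct d)"
proof -
  have int: "set_integrable lebesgue \<Omega> (\<lambda>x. f x * reconstruct d x)" for d
    using f represents_L2[OF represents_reconstruct] by (rule set_integrable_L2_mult)
  show "linear_coords (\<lambda>d. L2_inner \<Omega> f (reconstruct d))"
    unfolding L2_inner_def
  proof (rule linear_coords_integral[OF _ int])
    show "linear_coords (\<lambda>d. f x * reconstruct d x)" for x
      unfolding linear_coords_def reconstruct_linear by (simp add: algebra_simps)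
  qed
  show "L2_inner \<Omega> f \<eta> = L2_inner \<Omega> f (reconstruct d)" if \<eta>: "represents d \<eta>"
    unfolding L2_inner_def
  proof (rule lebesgue_spike(2)[OF _ _ int])
    show "negligible (\<Union>K\<in>T. frontier K)"
      using finite_cells cell by (intro negligible_Union) (auto intro!: negligible_convex_frontier)
    fix x assume x: "x \<in> \<Omega> - (\<Union>K\<in>T. frontier K)"
    then obtain K where K: "K \<in> T" "x \<in> K" using domain_subset_cells by auto
    then have "x \<in> interior K" using x cell(3)[OF K(1)] by (auto simp: frontier_def)
    then show "f x * \<eta> x = f x * reconstruct d x"
      using \<eta> represents_reconstruct[of d] K(1) by (simp add: represents_def)
  qed
qed

text \<open>The integrand is (v v^\<delta>)^2, which vanishes only where v does. A non-zero
  coefficient keeps v away from zero on a non-empty open subset of some cell within the domain, and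
  such a set has positive measure.\<close>

lemma reaction_2_pos:
  assumes "\<delta> \<ge> 1" and i: "i < 4 * card T" "c i \<noteq> 0"
  shows "reaction 2 \<delta> (reconstruct c) (reconstruct c) > 0"
proof -
  let ?v = "reconstruct c"
  let ?g = "\<lambda>x. ?v x * dpow \<delta> (?v x) ^ 2 * ?v x"
  have nonneg: "?g x \<ge> 0" for x
  proof -
    have "?g x = (?v x * dpow \<delta> (?v x))\<^sup>2" by (simp add: power2_eq_square mult_ac)
    then show ?thesis by simp
  qed
  have int: "set_integrable lebesgue \<Omega> ?g"
    using assms(1) represents_reconstruct represents_reconstruct by (rule reaction(2))
  have "i div 4 < card T" using i by simp
  then have "i div 4 \<in> h ` T" using bij_index by (simp add: bij_betw_def)
  then obtain K where K: "K \<in> T" "h K = i div 4" by auto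
  have op: "open (interior K \<inter> \<Omega>)" using open_domain by blast
  obtain x where x: "x \<in> interior K \<inter> \<Omega>" "cell_poly c (h K) x \<noteq> 0"
    using cell_poly_nonzero[OF op cell_meets_domain[OF K(1)] K(2)[symmetric], of c] i(2) by blast
  define U where "U = interior K \<inter> \<Omega> \<inter> {x. cell_poly c (h K) x \<noteq> 0}"
  have "open {x. cell_poly c (h K) x \<noteq> 0}"
    using continuous_cell_poly_space by (intro open_Collect_neq) auto
  then have "open U" "U \<noteq> {}" using op x by (auto simp: U_def)
  then have U: "\<not> negligible U" using open_not_negligible by blast
  have g_U: "?g x \<noteq> 0" if "x \<in> U" for x
    using that represents_reconstruct[of c] K(1) dpow_nonzero[OF assms(1)]
    by (auto simp: U_def represents_def)
  have "reaction 2 \<delta> ?v ?v \<noteq> 0"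
  proof
    assume "reaction 2 \<delta> ?v ?v = 0"
    then have "(LINT x|lebesgue. indicator \<Omega> x *\<^sub>R ?g x) = 0"
      by (simp add: reaction_def set_lebesgue_integral_def)
    then have "AE x in lebesgue. indicator \<Omega> x *\<^sub>R ?g x = 0"
      using int nonneg by (subst (asm) integral_nonneg_eq_0_iff_AE) (auto simp: set_integrable_def)
    then have "AE x in lebesgue. x \<notin> U"
      by eventually_elim (use g_U in \<open>auto simp: U_def\<close>)
    then have "negligible U"
      by (simp add: negligible_iff_null_sets completion.null_sets_iff_AE)
    then show False using U by simp
  qed
  moreover have "reaction 2 \<delta> ?v ?v \<ge> 0"
    unfolding reaction_def set_lebesgue_integral_def using nonneg
    by (intro Bochner_Integration.integral_nonneg) simp
  ultimately show ?thesis by simp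
qed

lemma discrete_problem_solvable:
  assumes "\<delta> \<ge> 1" "\<beta> > 0" "f \<in> L2 \<Omega>"
  shows "\<exists>u\<in>V_DG \<Omega> T. \<forall>\<eta>\<in>V_DG \<Omega> T. A_DG \<Omega> T \<sigma> \<nu> \<alpha> \<beta> \<gamma> \<delta> u \<eta> = L2_inner \<Omega> f \<eta>"
proof -
  \<comment> \<open>The sphere with index n has n + 1 coordinates, one for each of the
    \<open>4 * card T\<close> coefficients. The mesh is non-empty, so the subtraction is not
    truncated.\<close>
  define n where "n = 4 * card T - 1"
  have "T \<noteq> {}" using domain_subset_cells nonempty_domain by auto
  then have "card T > 0" using finite_cells by (simp add: card_gt_0_iff)
  then have n: "i \<le> n \<longleftrightarrow> i < 4 * card T" for i by (auto simp: n_def)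
  obtain Q0 where Q0: "homogeneous_form 1 Q0"
    "\<And>c d v \<eta>. represents c v \<Longrightarrow> represents d \<eta> \<Longrightarrow>
       \<nu> * a_DG \<Omega> T \<sigma> v \<eta> + \<beta> * \<gamma> * reaction 0 \<delta> v \<eta> = Q0 c d"
    using homogeneous_functional_add[OF
        homogeneous_functional_scale[OF homogeneous_functional_a_DG, of \<nu> \<sigma>]
        homogeneous_functional_scale[OF reaction(1)[OF assms(1), of 0], of "\<beta> * \<gamma>", simplified]]
    unfolding homogeneous_functional_def by blast
  have r1: "homogeneous_functional (\<delta> + 1) (reaction 1 \<delta>)"
    using reaction(1)[OF assms(1), of 1] by simp
  obtain Q1 where Q1: "homogeneous_form (\<delta> + 1) Q1"
    "\<And>c d v \<eta>. represents c v \<Longrightarrow> represents d \<eta> \<Longrightarrow>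
       \<alpha> * b_DG \<Omega> T (\<lambda>x. vector [dpow \<delta> (v x), dpow \<delta> (v x)]) v \<eta>
         + - (\<beta> * (1 + \<gamma>)) * reaction 1 \<delta> v \<eta> = Q1 c d"
    using homogeneous_functional_add[OF
        homogeneous_functional_scale[OF homogeneous_functional_b_DG[OF assms(1)], of \<alpha>]
        homogeneous_functional_scale[OF r1, of "- (\<beta> * (1 + \<gamma>))"]]
    unfolding homogeneous_functional_def by blast
  obtain Q2 where Q2: "homogeneous_form (real 2 * \<delta> + 1) Q2"
    "\<And>c d v \<eta>. represents c v \<Longrightarrow> represents d \<eta> \<Longrightarrow> \<beta> * reaction 2 \<delta> v \<eta> = Q2 c d"
    using homogeneous_functional_scale[OF reaction(1)[OF assms(1), of 2], of \<beta>]
    unfolding homogeneous_functional_def by blast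
  have "\<exists>c. \<forall>d. (\<forall>i>n. d i = 0) \<longrightarrow> Q0 c d + Q1 c d + Q2 c d = L2_inner \<Omega> f (reconstruct d)"
  \<comment> \<open>The degrees are p0 = 1, p1 = \<delta> + 1 and p2 = 2 \<delta> + 1, in increasing
    order because \<delta> is positive.\<close>
  proof (rule homogeneous_form_solvable[OF Q0(1) Q1(1) Q2(1)])
    fix c assume c: "c \<in> coord_sphere n"
    have "\<exists>i\<le>n. c i \<noteq> 0"
    proof (rule ccontr)
      assume "\<not> ?thesis"
      then have "(\<Sum>i\<le>n. (c i)\<^sup>2) = 0" by simp
      then show False using c by (simp add: coord_sphere_def)
    qed
    then have "reaction 2 \<delta> (reconstruct c) (reconstruct c) > 0"
      using reaction_2_pos[OF assms(1)] n by blast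
    then show "Q2 c c > 0"
      using Q2(2)[OF represents_reconstruct represents_reconstruct, of c c] assms(2) by (metis mult_pos_pos)
  qed (use assms L2_inner_represented(1) in auto)
  then obtain c where c: "\<And>d. \<forall>i>n. d i = 0 \<Longrightarrow> Q0 c d + Q1 c d + Q2 c d = L2_inner \<Omega> f (reconstruct d)"
    by blast
  have "A_DG \<Omega> T \<sigma> \<nu> \<alpha> \<beta> \<gamma> \<delta> (reconstruct c) \<eta> = L2_inner \<Omega> f \<eta>" if \<eta>: "\<eta> \<in> V_DG \<Omega> T" for \<eta>
  proof -
    obtain d where d: "represents d \<eta>" "\<forall>i\<ge>4 * card T. d i = 0"
      using V_DG_represented[OF \<eta>] by blast
    then have "\<forall>i>n. d i = 0" using n by (metis not_le)
    then show ?thesis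
      using c[of d] L2_inner_represented(2)[OF assms(3) d(1)]
      unfolding A_DG_by_degree[OF assms(1) represents_reconstruct d(1)]
        Q0(2)[OF represents_reconstruct d(1)] Q1(2)[OF represents_reconstruct d(1)]
        Q2(2)[OF represents_reconstruct d(1)] by simp
  qed
  then show ?thesis
    using reconstruct_in_V_DG by blast
qed

end

theorem theorem3p9:
  fixes \<Omega> :: "(real^2) set" and T :: "(real^2) set set"
    and \<nu> \<alpha> \<beta> \<gamma> \<delta> \<sigma> \<kappa> C k :: real and f :: "real^2 \<Rightarrow> real"
  assumes "open \<Omega>" "\<Omega> \<noteq> {}" "bounded \<Omega>" "simply_connected \<Omega>" "lipschitz_boundary \<Omega>"
    and "mesh \<Omega> T" "shape_regular \<kappa> T"
    and "\<nu> > 0" "\<alpha> > 0" "\<beta> > 0" "\<delta> \<ge> 1" "0 < \<gamma>" "\<gamma> < 1"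
    and "f \<in> L2 \<Omega>"
    and "\<sigma> > 0"
    and stability: "\<exists>\<alpha>\<^sub>a>0. \<forall>v\<in>V_DG \<Omega> T. a_DG \<Omega> T \<sigma> v v \<ge> \<alpha>\<^sub>a * (DG_norm \<Omega> T v)\<^sup>2"
    and "C > 0"
    and poincare: "\<forall>v\<in>V_DG \<Omega> T. (L2_norm \<Omega> v)\<^sup>2 \<le> C * (DG_norm \<Omega> T v)\<^sup>2"
    and "\<nu> + \<beta> * \<gamma> * C > \<beta> * (1 + \<gamma>)\<^sup>2 * C + 2 * \<alpha>\<^sup>2 / \<beta>"
    and "k > C / (\<nu> * sqrt (\<nu> + \<beta> * \<gamma> * C - \<beta> * (1 + \<gamma>)\<^sup>2 * C - 2 * \<alpha>\<^sup>2 / \<beta>)) * L2_norm \<Omega> f"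
  shows "\<exists>u\<in>V_DG \<Omega> T. \<forall>\<eta>\<in>V_DG \<Omega> T. A_DG \<Omega> T \<sigma> \<nu> \<alpha> \<beta> \<gamma> \<delta> u \<eta> = L2_inner \<Omega> f \<eta>"
  proof -
  have "finite T" using \<open>mesh \<Omega> T\<close> by (simp add: mesh_def)
  then obtain h where "bij_betw h T {..<card T}"
    using ex_bij_betw_finite_nat by (auto simp: lessThan_atLeast0)
  then interpret dg_mesh \<Omega> T h
    using assms by unfold_locales auto
  show ?thesis
    using discrete_problem_solvable assms by blast
qed

end
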